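(* Let $G$ be a finite connected undirected multigraph with vertices $v_1,\dots,v_n$, $q=v_n$. Let $\rho:\operatorname{Jac}(G)^*\to GL(\mathbb{C}^n)$ be $\rho(\chi)=\operatorname{diag}(\chi([v_1-q]),\dots,\chi([v_{n-1}-q]),1)$ and $\Gamma=\operatorname{im}(\rho)$. Regard each $[D]\in\operatorname{Jac}(G)$ as a character of $\Gamma$ via $[D](\rho(\chi))=\chi([D])$. Then: (1) $\{x^E=\prod_{i=1}^nx_i^{E(v_i)}:E\in\mathbb{E}_{[D]}\}$ is a $\mathbb{C}$-basis for the relative invariants $\mathbb{C}[x]^\Gamma_{[D]}$; (2) $\mathbb{C}[x]=\bigoplus_{[D]\in\operatorname{Jac}(G)}\mathbb{C}[x]^\Gamma_{[D]}$; (3) the correspondence $E\mapsto x^E$ for effective divisors $E$ gives a bijection between systems of primary and $[D]$-secondary divisors and systems of monomial primary invariants and $[D]$-relative secondary invariants of $\Gamma$.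
   Context: Divisors on $G$ are vectors in $\mathbb{Z}^n$ indexed by vertices; $\deg D=\sum_iD(v_i)$; $L=\mathrm{Deg}-A$ is the Laplacian matrix; $D\sim D'$ iff $D-D'\in\operatorname{im}_\mathbb{Z}L$; $\operatorname{Jac}(G)$ is degree-$0$ divisors modulo $\operatorname{im}_\mathbb{Z} L$ (a finite abelian group), $[D]$ the class, and $\operatorname{Jac}(G)^*=\operatorname{Hom}(\operatorname{Jac}(G),\mathbb{C}^\times)$. $E$ is effective if all $E(v)\ge0$; $|D|=\{E\ge 0:E\sim D\}$; $\mathbb{E}_{[D]}=\bigcup_{k\ge0}|D+kq|$. $\operatorname{ord}_q(v)$ is the order of $[v-q]$. A system of primary divisors is $\mathcal{P}=\{\ell_vv:v\in V\}$ with each $\ell_v$ a positive multiple of $\operatorname{ord}_q(v)$, and the corresponding $[D]$-secondary divisors are $\mathcal{S}_{[D]}=\{E\in\mathbb{E}_{[D]}:E(v)<\ell_v\ \forall v\}$; every $E\in\mathbb{E}_{[D]}$ is uniquely $F+\sum_{P\in\mathcal P}a_PP$ with $F\in\mathcal{S}_{[D]}$, $a_P\in\mathbb{N}$. For $A\in GL(\mathbb{C}^n)$ and $f\in\mathbb{C}[x]=\mathbb{C}[x_1,\dots,x_n]$, $(f\circ A)(x)=f(A\vec x)$. For a character $\chi$ of a finite group $\Gamma\subset GL(\mathbb{C}^n)$, $\mathbb{C}[x]^\Gamma_\chi=\{f: f\circ\gamma=\chi(\gamma)f\ \forall\gamma\in\Gamma\}$; $\mathbb{C}[x]^\Gamma$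 is the case of the trivial character. Primary invariants are algebraically independent homogeneous invariants $p_1,\dots,p_n$ such that $\mathbb{C}[x]^\Gamma$ is a finitely generated free $\mathbb{C}[p_1,\dots,p_n]$-module; $\chi$-relative secondary invariants are homogeneous $q_1,\dots,q_t$ forming a $\mathbb{C}$-basis of $\mathbb{C}[x]^\Gamma_\chi$ modulo $\sum_ip_i\mathbb{C}[x]^\Gamma_\chi$, so that $\mathbb{C}[x]^\Gamma_\chi=\bigoplus_jq_j\mathbb{C}[p_1,\dots,p_n]$. *)

theory Defs
  imports
    "HOL-Analysis.Analysis"
    "HOL-Algebra.Multiplicative_Group"
    "HOL-Library.Multiset"
    "HOL-Library.Uprod"
    "HOL-Library.Poly_Mapping"
begin

section \<open>Divisors on a multigraph\<close>

text \<open>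
  The vertex set is the finite type \<open>'v\<close>, so \<open>n = CARD('v)\<close>; a multigraph is the multiset of its
  edges. Loops are permitted; they contribute 2 to both the degree and the diagonal of the
  adjacency matrix, hence nothing to the Laplacian.
\<close>

type_synonym 'v multigraph = "'v uprod multiset"

type_synonym 'v divisor = "int ^ 'v"

definition connected_multigraph :: "'v::finite multigraph \<Rightarrow> bool" where
  "connected_multigraph G \<longleftrightarrow> (\<forall>u v. (u, v) \<in> {(a, b). Upair a b \<in># G}\<^sup>*)"

definition adjacency :: "'v::finite multigraph \<Rightarrow> int ^ 'v ^ 'v" where
  "adjacency G = (\<chi> u v. (if u = v then 2 else 1) * int (count G (Upair u v)))"

definition degree_matrix :: "'v::finite multigraph \<Rightarrow> int ^ 'v ^ 'v" where
  "degree_matrix G = (\<chi> u v. if u = v then \<Sum>w\<in>UNIV. adjacency G $ u $ w else 0)"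

definition laplacian :: "'v::finite multigraph \<Rightarrow> int ^ 'v ^ 'v" where
  "laplacian G = degree_matrix G - adjacency G"

definition vertex_div :: "'v::finite \<Rightarrow> 'v divisor" where
  "vertex_div v = axis v 1"

definition div_degree :: "'v::finite divisor \<Rightarrow> int" where
  "div_degree D = (\<Sum>v\<in>UNIV. D $ v)"

definition principal :: "'v::finite multigraph \<Rightarrow> 'v divisor set" where
  "principal G = range (\<lambda>f. laplacian G *v f)"

definition lin_equiv :: "'v::finite multigraph \<Rightarrow> 'v divisor \<Rightarrow> 'v divisor \<Rightarrow> bool" where
  "lin_equiv G D D' \<longleftrightarrow> D - D' \<in> principal G"

definition effective :: "'v::finite divisor \<Rightarrow> bool" where
  "effective E \<longleftrightarrow> (\<forall>v. E $ v \<ge> 0)"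

definition linear_system :: "'v::finite multigraph \<Rightarrow> 'v divisor \<Rightarrow> 'v divisor set" where
  "linear_system G D = {E. effective E \<and> lin_equiv G E D}"

definition effective_class :: "'v::finite multigraph \<Rightarrow> 'v \<Rightarrow> 'v divisor \<Rightarrow> 'v divisor set" where
  "effective_class G q D = (\<Union>k::nat. linear_system G (D + int k *s vertex_div q))"


section \<open>The Jacobian group and its dual\<close>

definition Div0 :: "'v::finite divisor monoid" where
  "Div0 = \<lparr>carrier = {D. div_degree D = 0}, monoid.mult = (+), one = 0\<rparr>"

definition Jac :: "'v::finite multigraph \<Rightarrow> 'v divisor set monoid" where
  "Jac G = Div0 Mod principal G"

definition jac_class :: "'v::finite multigraph \<Rightarrow> 'v divisor \<Rightarrow> 'v divisor set" where
  "jac_class G D = principal G #>\<^bsub>Div0\<^esub> D"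

definition complex_units :: "complex monoid" where
  "complex_units = \<lparr>carrier = UNIV - {0}, monoid.mult = (*), one = 1\<rparr>"

text \<open>
  Homomorphisms are only specified on the carrier, so they are taken to be extensional in order
  that distinct elements of the dual are distinct characters.
\<close>

definition jac_dual :: "'v::finite multigraph \<Rightarrow> ('v divisor set \<Rightarrow> complex) set" where
  "jac_dual G = hom (Jac G) complex_units \<inter> extensional (carrier (Jac G))"

definition ord_q :: "'v::finite multigraph \<Rightarrow> 'v \<Rightarrow> 'v \<Rightarrow> nat" where
  "ord_q G q v = group.ord (Jac G) (jac_class G (vertex_div v - vertex_div q))"

definition rho :: "'v::finite multigraph \<Rightarrow> 'v \<Rightarrow> ('v divisor set \<Rightarrow> complex) \<Rightarrow> complex ^ 'v ^ 'v"
  where "rho G q phi = (\<chi> u v. if u = v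
     then (if v = q then 1 else phi (jac_class G (vertex_div v - vertex_div q))) else 0)"

definition Jac_Gamma :: "'v::finite multigraph \<Rightarrow> 'v \<Rightarrow> (complex ^ 'v ^ 'v) set" where
  "Jac_Gamma G q = rho G q ` jac_dual G"

text \<open>
  An element of the Jacobian as a character of \<open>Jac_Gamma G q\<close>. The map \<open>rho\<close> is injective
  (\<open>inj_on_rho\<close> below), so the preimage is unique and the defining relation holds
  (\<open>jac_char_rho\<close>).
\<close>

definition jac_char ::
    "'v::finite multigraph \<Rightarrow> 'v \<Rightarrow> 'v divisor set \<Rightarrow> complex ^ 'v ^ 'v \<Rightarrow> complex" where
  "jac_char G q c g = inv_into (jac_dual G) (rho G q) g c"


section \<open>Primary and secondary divisors\<close>

definition primary_multiplicities :: "'v::finite multigraph \<Rightarrow> 'v \<Rightarrow> ('v \<Rightarrow> nat) \<Rightarrow> bool" where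
  "primary_multiplicities G q l \<longleftrightarrow> (\<forall>v. 0 < l v \<and> ord_q G q v dvd l v)"

definition primary_divisors :: "('v::finite \<Rightarrow> nat) \<Rightarrow> 'v divisor set" where
  "primary_divisors l = range (\<lambda>v. int (l v) *s vertex_div v)"

definition secondary_divisors ::
    "'v::finite multigraph \<Rightarrow> 'v \<Rightarrow> 'v divisor \<Rightarrow> ('v \<Rightarrow> nat) \<Rightarrow> 'v divisor set" where
  "secondary_divisors G q D l = {E \<in> effective_class G q D. \<forall>v. E $ v < int (l v)}"


section \<open>Polynomials\<close>

type_synonym 'v cpoly = "('v \<Rightarrow>\<^sub>0 nat) \<Rightarrow>\<^sub>0 complex"

definition const_poly :: "complex \<Rightarrow> 'v cpoly" where
  "const_poly c = Poly_Mapping.single 0 c"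

definition var_poly :: "'v \<Rightarrow> 'v cpoly" where
  "var_poly v = Poly_Mapping.single (Poly_Mapping.single v 1) 1"

definition scale_poly :: "complex \<Rightarrow> 'v cpoly \<Rightarrow> 'v cpoly" where
  "scale_poly c f = const_poly c * f"

global_interpretation cpoly: vector_space scale_poly
  by unfold_locales
    (simp_all add: scale_poly_def const_poly_def algebra_simps single_add mult_single
      flip: mult.assoc)

definition subst_poly :: "('v::finite \<Rightarrow> 'w cpoly) \<Rightarrow> 'v cpoly \<Rightarrow> 'w cpoly" where
  "subst_poly g f = (\<Sum>m\<in>Poly_Mapping.keys f.
     scale_poly (Poly_Mapping.lookup f m) (\<Prod>v\<in>UNIV. g v ^ Poly_Mapping.lookup m v))"

definition compose_matrix :: "'v::finite cpoly \<Rightarrow> complex ^ 'v ^ 'v \<Rightarrow> 'v cpoly" where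
  "compose_matrix f A = subst_poly (\<lambda>v. \<Sum>w\<in>UNIV. scale_poly (A $ v $ w) (var_poly w)) f"

text \<open>Only meaningful for effective \<open>E\<close>.\<close>

definition div_monomial :: "'v::finite divisor \<Rightarrow> 'v cpoly" where
  "div_monomial E = (\<Prod>v\<in>UNIV. var_poly v ^ nat (E $ v))"

definition monomials :: "'v::finite cpoly set" where
  "monomials = div_monomial ` {E. effective E}"

definition homogeneous_poly :: "'v::finite cpoly \<Rightarrow> bool" where
  "homogeneous_poly f \<longleftrightarrow>
     (\<exists>d. \<forall>m\<in>Poly_Mapping.keys f. (\<Sum>v\<in>UNIV. Poly_Mapping.lookup m v) = d)"


section \<open>Relative invariants\<close>

definition rel_invariants ::
    "(complex ^ 'v ^ 'v) set \<Rightarrow> (complex ^ 'v ^ 'v \<Rightarrow> complex) \<Rightarrow> 'v::finite cpoly set" where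
  "rel_invariants \<Gamma> psi = {f. \<forall>g\<in>\<Gamma>. compose_matrix f g = scale_poly (psi g) f}"

abbreviation invariants :: "(complex ^ 'v ^ 'v) set \<Rightarrow> 'v::finite cpoly set" where
  "invariants \<Gamma> \<equiv> rel_invariants \<Gamma> (\<lambda>_. 1)"

definition alg_independent :: "('v::finite \<Rightarrow> 'v cpoly) \<Rightarrow> bool" where
  "alg_independent p \<longleftrightarrow> (\<forall>f. subst_poly p f = 0 \<longrightarrow> f = 0)"

definition gen_subalgebra :: "('v::finite \<Rightarrow> 'v cpoly) \<Rightarrow> 'v cpoly set" where
  "gen_subalgebra p = range (subst_poly p)"

definition fin_free_module :: "'v::finite cpoly set \<Rightarrow> 'v cpoly set \<Rightarrow> bool" where
  "fin_free_module R M \<longleftrightarrow>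
     (\<exists>B. finite B \<and> B \<subseteq> M \<and> bij_betw (\<lambda>a. \<Sum>b\<in>B. a b * b) (B \<rightarrow>\<^sub>E R) M)"

text \<open>The \<open>n\<close> primary invariants are indexed by the \<open>n\<close> vertices; the order is immaterial.\<close>

definition primary_invariants ::
    "(complex ^ 'v ^ 'v) set \<Rightarrow> ('v::finite \<Rightarrow> 'v cpoly) \<Rightarrow> bool" where
  "primary_invariants \<Gamma> p \<longleftrightarrow>
     (\<forall>v. homogeneous_poly (p v) \<and> p v \<in> invariants \<Gamma>) \<and>
     alg_independent p \<and>
     fin_free_module (gen_subalgebra p) (invariants \<Gamma>)"

definition basis_modulo :: "'v cpoly set \<Rightarrow> 'v cpoly set \<Rightarrow> 'v cpoly set \<Rightarrow> bool" where
  "basis_modulo Q M W \<longleftrightarrow> finite Q \<and> Q \<subseteq> M \<and>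
     (\<forall>f\<in>M. \<exists>!a. a \<in> (Q \<rightarrow>\<^sub>E UNIV) \<and> f - (\<Sum>b\<in>Q. scale_poly (a b) b) \<in> W)"

definition secondary_invariants ::
    "(complex ^ 'v ^ 'v) set \<Rightarrow> (complex ^ 'v ^ 'v \<Rightarrow> complex) \<Rightarrow>
      ('v::finite \<Rightarrow> 'v cpoly) \<Rightarrow> 'v cpoly set \<Rightarrow> bool" where
  "secondary_invariants \<Gamma> psi p Q \<longleftrightarrow>
     (\<forall>f\<in>Q. homogeneous_poly f) \<and>
     basis_modulo Q (rel_invariants \<Gamma> psi)
       {\<Sum>v\<in>UNIV. p v * h v | h. \<forall>v. h v \<in> rel_invariants \<Gamma> psi}"


section \<open>The Jacobian acts as characters\<close>

lemma comm_group_Div0: "comm_group (Div0 :: 'v::finite divisor monoid)"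
proof (rule comm_groupI)
  fix x :: "'v divisor" assume "x \<in> carrier Div0"
  then show "\<exists>y\<in>carrier Div0. y \<otimes>\<^bsub>Div0\<^esub> x = \<one>\<^bsub>Div0\<^esub>"
    by (intro bexI[of _ "- x"]) (auto simp: Div0_def div_degree_def sum_negf)
qed (auto simp: Div0_def div_degree_def sum.distrib algebra_simps)

lemma adjacency_sym: "adjacency G $ u $ v = adjacency G $ v $ u"
proof -
  have "Upair u v = Upair v u" by simp
  then have "count G (Upair u v) = count G (Upair v u)" by (rule arg_cong)
  moreover have "(u = v) = (v = u)" by (rule eq_commute)
  ultimately show ?thesis unfolding adjacency_def vec_lambda_beta by presburger
qed

lemma degree_laplacian: "div_degree (laplacian G *v f) = 0"
proof -
  have "div_degree (laplacian G *v f) =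
      (\<Sum>u\<in>UNIV. \<Sum>v\<in>UNIV. degree_matrix G $ u $ v * f $ v) -
      (\<Sum>u\<in>UNIV. \<Sum>v\<in>UNIV. adjacency G $ u $ v * f $ v)"
    by (simp add: div_degree_def laplacian_def matrix_vector_mult_def left_diff_distrib
        sum_subtractf)
  also have "(\<Sum>u\<in>UNIV. \<Sum>v\<in>UNIV. degree_matrix G $ u $ v * f $ v) =
      (\<Sum>u\<in>UNIV. (\<Sum>w\<in>UNIV. adjacency G $ u $ w) * f $ u)"
    by (simp add: degree_matrix_def if_distrib[of "\<lambda>x. x * _"] cong: if_cong)
  also have "\<dots> = (\<Sum>u\<in>UNIV. \<Sum>v\<in>UNIV. adjacency G $ v $ u * f $ u)"
    by (simp add: sum_distrib_right adjacency_sym)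
  also have "\<dots> = (\<Sum>u\<in>UNIV. \<Sum>v\<in>UNIV. adjacency G $ u $ v * f $ v)"
    by (rule sum.swap)
  finally show ?thesis by simp
qed

lemma normal_principal: "principal G \<lhd> Div0"
proof -
  interpret D: comm_group "Div0 :: 'a divisor monoid" by (rule comm_group_Div0)
  have inv: "inv\<^bsub>Div0\<^esub> x = - x" if "div_degree x = 0" for x :: "'a divisor"
    by (rule D.inv_equality) (use that in \<open>auto simp: Div0_def div_degree_def sum_negf\<close>)
  have "subgroup (principal G) Div0"
  proof (rule D.subgroupI)
    show "principal G \<subseteq> carrier Div0"
      by (auto simp: principal_def Div0_def degree_laplacian)
    show "principal G \<noteq> {}" by (auto simp: principal_def)
    show "inv\<^bsub>Div0\<^esub> a \<in> principal G" if "a \<in> principal G" for a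
    proof -
      from that obtain f where f: "a = laplacian G *v f" by (auto simp: principal_def)
      then have "- a = laplacian G *v (- f)"
        by (simp add: vec_eq_iff matrix_vector_mult_def sum_negf)
      with inv[of a] f show ?thesis by (auto simp: principal_def degree_laplacian)
    qed
    show "a \<otimes>\<^bsub>Div0\<^esub> b \<in> principal G" if "a \<in> principal G" "b \<in> principal G" for a b
      using that by (auto simp: principal_def Div0_def simp flip: matrix_vector_right_distrib)
  qed
  then show ?thesis by (rule D.subgroup_imp_normal)
qed

lemma comm_group_Jac: "comm_group (Jac G)"
  unfolding Jac_def
  using comm_group.abelian_FactGroup[OF comm_group_Div0] normal_principal normal_imp_subgroup
  by blast

lemma carrier_Jac: "carrier (Jac G) = jac_class G ` {D. div_degree D = 0}"
  by (simp add: Jac_def carrier_FactGroup jac_class_def[abs_def]) (simp add: Div0_def)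

lemma jac_class_add:
  assumes "div_degree D = 0" "div_degree D' = 0"
  shows "jac_class G (D + D') = jac_class G D \<otimes>\<^bsub>Jac G\<^esub> jac_class G D'"
  using normal.rcos_sum[OF normal_principal[of G], of D D'] assms
  by (simp add: Jac_def jac_class_def) (simp add: Div0_def)

lemma divisor_decompose:
  fixes D :: "'v::finite divisor"
  assumes "div_degree D = 0"
  shows "D = (\<Sum>v\<in>UNIV. (D $ v) *s (vertex_div v - vertex_div q))"
proof -
  have "(\<Sum>v\<in>UNIV. (D $ v) * ((if v = u then 1 else 0) - c)) = D $ u" for u c
  proof -
    have "(\<Sum>v\<in>UNIV. (D $ v) * ((if v = u then 1 else 0) - c)) =
        (\<Sum>v\<in>UNIV. if v = u then D $ v else 0) - (\<Sum>v\<in>UNIV. D $ v) * c"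
      unfolding sum_distrib_right sum_subtractf[symmetric] by (rule sum.cong) (auto simp: algebra_simps)
    then show ?thesis using assms by (simp add: div_degree_def)
  qed
  moreover have "(vertex_div v - vertex_div q) $ u = (if v = u then 1 else 0) - vertex_div q $ u"
    for u v :: 'v by (auto simp: vertex_div_def axis_def)
  ultimately show ?thesis by (simp only: vec_eq_iff sum_component vector_smult_component) simp
qed

lemma jac_hom_eqI:
  assumes phi: "phi \<in> hom (Jac G) complex_units" and psi: "psi \<in> hom (Jac G) complex_units"
    and eq: "\<And>v. phi (jac_class G (vertex_div v - vertex_div q)) =
                  psi (jac_class G (vertex_div v - vertex_div q))"
    and D: "div_degree D = 0"
  shows "phi (jac_class G D) = psi (jac_class G D)"
proof -
  let ?K = "{D. div_degree D = 0 \<and> phi (jac_class G D) = psi (jac_class G D)}"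
  have mult: "h (jac_class G (A + B)) = h (jac_class G A) * h (jac_class G B)"
    if "h \<in> hom (Jac G) complex_units" "div_degree A = 0" "div_degree B = 0" for h A B
    using that hom_mult[OF that(1)] by (simp add: jac_class_add carrier_Jac complex_units_def)
  have nz: "h (jac_class G A) \<noteq> 0"
    if "h \<in> hom (Jac G) complex_units" "div_degree A = 0" for h A
    using that hom_in_carrier[OF that(1), of "jac_class G A"]
    by (auto simp: carrier_Jac complex_units_def)
  have deg_add: "div_degree (A + B) = div_degree A + div_degree B" for A B :: "'a divisor"
    by (simp add: div_degree_def sum.distrib)
  have deg_minus: "div_degree (A - B) = div_degree A - div_degree B" for A B :: "'a divisor"
    by (simp add: div_degree_def sum_subtractf)
  have add: "A + B \<in> ?K" if "A \<in> ?K" "B \<in> ?K" for A B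
    using that by (simp add: mult[OF phi] mult[OF psi] deg_add)
  have zero: "0 \<in> ?K"
  proof -
    have d: "div_degree (0::'a divisor) = 0" by (simp add: div_degree_def)
    show ?thesis using mult[OF phi d d] mult[OF psi d d] nz[OF phi d] nz[OF psi d] d by simp
  qed
  have minus: "A - B \<in> ?K" if "A \<in> ?K" "B \<in> ?K" for A B
  proof -
    have d: "div_degree (A - B) = 0" "div_degree B = 0" using that by (simp_all add: deg_minus)
    show ?thesis using mult[OF phi d] mult[OF psi d] nz[OF phi d(2)] nz[OF psi d(2)] that d by simp
  qed
  have gen: "vertex_div v - vertex_div q \<in> ?K" for v
    using eq[of v] by (simp add: deg_minus) (simp add: div_degree_def vertex_div_def axis_def)
  have smult: "k *s A \<in> ?K" if "A \<in> ?K" for A and k :: int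
  proof (induction k rule: int_induct[where k = 0])
    case base
    then show ?case using zero by simp
  next
    case (step1 i)
    have "(i + 1) *s A = i *s A + A" by (simp add: vec_eq_iff algebra_simps)
    then show ?case using add[OF step1(2) that] by (simp only:)
  next
    case (step2 i)
    have "(i - 1) *s A = i *s A - A" by (simp add: vec_eq_iff algebra_simps)
    then show ?case using minus[OF step2(2) that] by (simp only:)
  qed
  have "(\<Sum>v\<in>S. (D $ v) *s (vertex_div v - vertex_div q)) \<in> ?K" for S
    using finite[of S]
  proof (induction S rule: finite_induct)
    case empty
    then show ?case using zero by simp
  next
    case (insert x F)
    show ?case unfolding sum.insert[OF insert.hyps] by (rule add[OF smult[OF gen] insert.IH])
  qed
  from this[of UNIV] divisor_decompose[OF D, of q] show ?thesis by simp
qed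

lemma inj_on_rho: "inj_on (rho G q) (jac_dual G)"
proof (rule inj_onI)
  fix phi psi assume phi: "phi \<in> jac_dual G" and psi: "psi \<in> jac_dual G"
    and eq: "rho G q phi = rho G q psi"
  have hom: "phi \<in> hom (Jac G) complex_units" "psi \<in> hom (Jac G) complex_units"
    using phi psi by (auto simp: jac_dual_def)
  interpret J: comm_group "Jac G" by (rule comm_group_Jac)
  have one: "h (jac_class G 0) = 1" if "h \<in> hom (Jac G) complex_units" for h
  proof -
    have d: "div_degree (0::'a divisor) = 0" by (simp add: div_degree_def)
    have "jac_class G 0 \<in> carrier (Jac G)" using d by (auto simp: carrier_Jac)
    moreover have "jac_class G 0 = jac_class G 0 \<otimes>\<^bsub>Jac G\<^esub> jac_class G 0"
      using jac_class_add[OF d d, of G] by simp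
    ultimately have "h (jac_class G 0) = h (jac_class G 0) * h (jac_class G 0)"
        "h (jac_class G 0) \<noteq> 0"
      using hom_mult[OF that, of "jac_class G 0" "jac_class G 0"]
        hom_in_carrier[OF that, of "jac_class G 0"]
      by (auto simp: complex_units_def)
    then show ?thesis by simp
  qed
  have "phi (jac_class G (vertex_div v - vertex_div q)) =
        psi (jac_class G (vertex_div v - vertex_div q))" for v
  proof (cases "v = q")
    case True
    then show ?thesis using one[OF hom(1)] one[OF hom(2)] by simp
  next
    case False
    have "rho G q phi $ v $ v = rho G q psi $ v $ v" using eq by simp
    with False show ?thesis by (simp add: rho_def)
  qed
  from jac_hom_eqI[OF hom this] have "phi c = psi c" if "c \<in> carrier (Jac G)" for c
    using that by (auto simp: carrier_Jac)
  then show "phi = psi"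
    using phi psi by (intro extensionalityI[of _ "carrier (Jac G)"]) (auto simp: jac_dual_def)
qed

lemma jac_char_rho: "phi \<in> jac_dual G \<Longrightarrow> jac_char G q c (rho G q phi) = phi c"
  by (simp add: jac_char_def inv_into_f_f[OF inj_on_rho])

end

theory Submission
  imports Defs
begin

text \<open>
  A diagonal matrix maps each monomial to a multiple of itself, and \<open>rho(chi)\<close> multiplies \<open>x^m\<close>
  by the value of \<open>chi\<close> at the class of \<open>m - deg(m) q\<close>. Since the characters of the Jacobian separate
  its points, the relative invariants for \<open>[D]\<close> are exactly the polynomials whose monomials all
  lie in the class \<open>[D]\<close>; parts (1) and (2) follow. To separate points one uses the
  characters \<open>D \<mapsto> exp(2 pi i \<langle>y, D\<rangle>)\<close>, where \<open>y\<close> is a real solution of \<open>L y = u - q\<close>.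

  For (3), pure powers \<open>x_v^l_v\<close> with \<open>ord_q(v)\<close> dividing \<open>l_v\<close> are primary invariants by division with
  remainder in every exponent. Conversely, if the invariants are finitely generated over the algebra
  generated by \<open>n\<close> monomials, then a pure power of every variable must occur among these, so they
  are pure powers of the \<open>n\<close> variables. Modulo such primary invariants, a basis of monomials has to
  consist of all the monomials in the class that no primary invariant divides.
\<close>

subsection \<open>Characters separate the points of the Jacobian\<close>

definition real_laplacian :: "'v::finite multigraph \<Rightarrow> real ^ 'v ^ 'v" where
  "real_laplacian G = (\<chi> u v. real_of_int (laplacian G $ u $ v))"

definition real_divisor :: "'v::finite divisor \<Rightarrow> real ^ 'v" where
  "real_divisor D = (\<chi> v. real_of_int (D $ v))"

lemma adjacency_nonneg: "0 \<le> adjacency G $ u $ v"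
  by (simp add: adjacency_def)

lemma adjacency_pos: "Upair u v \<in># G \<Longrightarrow> 0 < adjacency G $ u $ v"
  by (simp add: adjacency_def)

lemma laplacian_sym: "laplacian G $ u $ v = laplacian G $ v $ u"
  by (simp add: laplacian_def degree_matrix_def adjacency_sym[of G u v])

text \<open>In this difference form the diagonal terms vanish and constants visibly lie in the
  kernel. At a maximum of \<open>y\<close> every summand is nonnegative, which drives the maximum
  principle.\<close>

lemma real_laplacian_mult_component:
  "(real_laplacian G *v y) $ u = (\<Sum>w\<in>UNIV. real_of_int (adjacency G $ u $ w) * (y $ u - y $ w))"
proof -
  have "(real_laplacian G *v y) $ u =
      (\<Sum>w\<in>UNIV. (if u = w then (\<Sum>x\<in>UNIV. real_of_int (adjacency G $ u $ x)) * y $ w else 0)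
         - real_of_int (adjacency G $ u $ w) * y $ w)"
    unfolding matrix_vector_mult_def real_laplacian_def laplacian_def degree_matrix_def
    by (auto intro!: sum.cong simp: algebra_simps)
  then show ?thesis
    by (simp add: sum_subtractf right_diff_distrib sum_distrib_right)
qed

lemma real_laplacian_mult_real_divisor:
  "real_laplacian G *v real_divisor f = real_divisor (laplacian G *v f)"
  by (simp add: vec_eq_iff real_laplacian_def real_divisor_def matrix_vector_mult_def)

lemma inner_real_laplacian:
  "y \<bullet> (real_laplacian G *v z) = (real_laplacian G *v y) \<bullet> z"
proof -
  have "y v* real_laplacian G = real_laplacian G *v y"
    by (simp add: vec_eq_iff vector_matrix_mult_def matrix_vector_mult_def real_laplacian_def
        laplacian_sym[of G] mult.commute)
  then show ?thesis by (metis dot_lmul_matrix)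
qed

text \<open>The sum is the inner product with the all-ones vector \<open>1\<close>; self-adjointness
  moves the Laplacian onto that vector, which it kills.\<close>

lemma sum_real_laplacian_mult: "(\<Sum>u\<in>UNIV. (real_laplacian G *v y) $ u) = 0"
proof -
  have "real_laplacian G *v 1 = 0"
    by (simp add: vec_eq_iff real_laplacian_mult_component)
  then have "1 \<bullet> (real_laplacian G *v y) = 0" by (simp add: inner_real_laplacian)
  then show ?thesis by (simp add: inner_vec_def)
qed

text \<open>Maximum principle: a harmonic function attains its maximum on a set closed under adjacency.\<close>

lemma real_laplacian_kernel:
  assumes conn: "connected_multigraph G" and ker: "real_laplacian G *v y = 0"
  shows "y $ u = y $ v"
proof -
  define M where "M = Max (range (($) y))"
  have le: "y $ w \<le> M" for w unfolding M_def by (rule Max_ge) auto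
  have "M \<in> range (($) y)" unfolding M_def by (rule Max_in) auto
  then obtain a where a: "y $ a = M" by auto
  have step: "y $ c = M" if b: "y $ b = M" and e: "Upair b c \<in># G" for b c
  proof -
    \<comment> \<open>At a maximum the summands are nonnegative with sum zero, so each vanishes; a
      positive edge multiplicity then passes the maximum to the neighbour.\<close>
    have "(\<Sum>w\<in>UNIV. real_of_int (adjacency G $ b $ w) * (M - y $ w)) = 0"
      using real_laplacian_mult_component[of G y b] ker b by simp
    then have "real_of_int (adjacency G $ b $ c) * (M - y $ c) = 0"
      by (subst (asm) sum_nonneg_eq_0_iff) (auto simp: adjacency_nonneg le)
    then show ?thesis using adjacency_pos[OF e] by simp
  qed
  have "y $ w = M" for w
  proof -
    have "(a, w) \<in> {(a, b). Upair a b \<in># G}\<^sup>*"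
      using conn by (auto simp: connected_multigraph_def)
    then show ?thesis by (induction rule: rtrancl_induct) (use a step in auto)
  qed
  then show ?thesis by metis
qed

text \<open>Raising the diagonal entry at \<open>q\<close> by 1 makes the singular Laplacian
  invertible while keeping the index type; deleting the row and column of \<open>q\<close> would
  change it.\<close>

definition grounded_laplacian :: "'v::finite multigraph \<Rightarrow> 'v \<Rightarrow> real ^ 'v ^ 'v" where
  "grounded_laplacian G q = real_laplacian G + (\<chi> u v. if u = q \<and> v = q then 1 else 0)"

lemma grounded_laplacian_mult:
  "grounded_laplacian G q *v y = real_laplacian G *v y + axis q (y $ q)"
proof -
  have "(\<Sum>v\<in>UNIV. (if u = q \<and> v = q then 1 else 0) * y $ v) = axis q (y $ q) $ u" for u
    by (cases "u = q") (auto simp: axis_def if_distrib[of "\<lambda>x. x * _"] cong: if_cong)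
  then show ?thesis
    by (simp add: vec_eq_iff grounded_laplacian_def matrix_vector_mult_def distrib_right sum.distrib)
qed

text \<open>Sum the coordinates of the equation: the Laplacian part and \<open>b\<close> contribute
  0, so the extra term \<open>y $ q\<close> must be 0, and what remains is the original
  system.\<close>

lemma grounded_laplacian_solution:
  assumes "(\<Sum>v\<in>UNIV. b $ v) = 0" "grounded_laplacian G q *v y = b"
  shows "y $ q = 0" "real_laplacian G *v y = b"
proof -
  have "(\<Sum>v\<in>UNIV. (real_laplacian G *v y + axis q (y $ q)) $ v) = 0"
    using assms by (simp add: grounded_laplacian_mult)
  then show 0: "y $ q = 0"
    by (simp add: sum.distrib sum_real_laplacian_mult) (simp add: axis_def)
  show "real_laplacian G *v y = b"
    using assms(2) 0 by (simp add: grounded_laplacian_mult) (simp add: axis_def vec_eq_iff)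
qed

text \<open>A kernel vector vanishes at \<open>q\<close> and lies in the kernel of the Laplacian,
  hence is constant by connectedness, hence zero.\<close>

lemma det_grounded_laplacian:
  assumes "connected_multigraph G"
  shows "det (grounded_laplacian G q) \<noteq> 0"
proof -
  have "y = 0" if "grounded_laplacian G q *v y = 0" for y
  proof -
    have 0: "y $ q = 0" "real_laplacian G *v y = 0"
      using grounded_laplacian_solution[OF _ that] by auto
    have "y $ v = 0" for v using real_laplacian_kernel[OF assms 0(2), of v q] 0(1) by (rule trans)
    then show ?thesis by (simp add: vec_eq_iff)
  qed
  then have "\<exists>B. B ** grounded_laplacian G q = mat 1" by (simp add: matrix_left_invertible_ker)
  then show ?thesis by (simp add: invertible_left_inverse flip: invertible_det_nz)
qed

text \<open>The explicit quotient of determinants is kept because it bounds the denominators of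
  \<open>y\<close> when \<open>b\<close> is integral.\<close>

lemma ex_real_laplacian_preimage:
  assumes "connected_multigraph G" "(\<Sum>v\<in>UNIV. b $ v) = 0"
  obtains y where "real_laplacian G *v y = b" "y $ q = 0"
    "\<And>v. y $ v = det (\<chi> i j. if j = v then b $ i else grounded_laplacian G q $ i $ j) /
                 det (grounded_laplacian G q)"
proof -
  let ?y = "\<chi> v. det (\<chi> i j. if j = v then b $ i else grounded_laplacian G q $ i $ j) /
                 det (grounded_laplacian G q)"
  have y: "grounded_laplacian G q *v ?y = b"
    using cramer[OF det_grounded_laplacian[OF assms(1)]] by blast
  show ?thesis
    by (rule that[of ?y]) (use grounded_laplacian_solution[OF assms(2) y] in auto)
qed

lemma det_in_Ints:
  fixes A :: "'a::comm_ring_1 ^ 'n ^ 'n"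
  assumes "\<And>i j. A $ i $ j \<in> \<int>"
  shows "det A \<in> \<int>"
  unfolding det_def using assms by (intro Ints_sum Ints_mult Ints_prod) auto

lemma real_divisor_inject: "real_divisor D = real_divisor E \<longleftrightarrow> D = E"
  by (simp add: real_divisor_def vec_eq_iff)

lemma sum_real_divisor: "(\<Sum>v\<in>UNIV. real_divisor D $ v) = real_of_int (div_degree D)"
  by (simp add: real_divisor_def div_degree_def)

lemma real_divisorE:
  assumes "\<And>v. y $ v \<in> \<int>"
  obtains f where "y = real_divisor f"
proof
  show "y = real_divisor (\<chi> v. \<lfloor>y $ v\<rfloor>)"
    using assms by (simp add: real_divisor_def vec_eq_iff)
qed

text \<open>Cramer's rule: the determinant of the grounded Laplacian annihilates the Jacobian.\<close>

lemma ex_exponent_Jac: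
  fixes G :: "'v::finite multigraph"
  assumes "connected_multigraph G"
  obtains N :: nat where "0 < N"
    "\<And>D. div_degree D = 0 \<Longrightarrow> int N *s D \<in> principal G"
proof -
  obtain q :: 'v where True by simp
  let ?A = "grounded_laplacian G q"
  have A: "?A $ i $ j \<in> \<int>" for i j
    by (simp add: grounded_laplacian_def real_laplacian_def)
  have nz: "det ?A \<noteq> 0" by (rule det_grounded_laplacian[OF assms])
  obtain d where d: "det ?A = real_of_int d" using det_in_Ints[OF A] by (auto elim: Ints_cases)
  show ?thesis
  proof
    show "0 < nat \<bar>d\<bar>" using nz d by simp
    fix D :: "'v divisor" assume D: "div_degree D = 0"
    then have "(\<Sum>v\<in>UNIV. real_divisor D $ v) = 0" by (simp add: sum_real_divisor)
    then obtain y where y: "real_laplacian G *v y = real_divisor D"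
      "\<And>v. y $ v = det (\<chi> i j. if j = v then real_divisor D $ i else ?A $ i $ j) / det ?A"
      by (rule ex_real_laplacian_preimage[OF assms, where q = q]) blast
    \<comment> \<open>Multiplying by \<open>d\<close> clears the denominator in Cramer's rule and
      leaves the determinant of an integer matrix. The absolute value makes the exponent a natural
      number.\<close>
    have "((real_of_int \<bar>d\<bar>) *\<^sub>R y) $ v \<in> \<int>" for v
    proof -
      have "det (\<chi> i j. if j = v then real_divisor D $ i else ?A $ i $ j) \<in> \<int>"
        by (rule det_in_Ints) (simp add: A real_divisor_def)
      moreover have "real_of_int d * y $ v =
          det (\<chi> i j. if j = v then real_divisor D $ i else ?A $ i $ j)"
        using nz by (simp add: y(2) d)
      ultimately show ?thesis by (auto simp: abs_if)
    qed
    then obtain f where f: "(real_of_int \<bar>d\<bar>) *\<^sub>R y = real_divisor f"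
      using real_divisorE by metis
    have "real_divisor (laplacian G *v f) = (real_of_int \<bar>d\<bar>) *\<^sub>R real_divisor D"
      by (simp flip: real_laplacian_mult_real_divisor f y(1) add: matrix_vector_mult_scaleR)
    also have "\<dots> = real_divisor (int (nat \<bar>d\<bar>) *s D)"
      by (simp add: real_divisor_def vec_eq_iff)
    finally have "int (nat \<bar>d\<bar>) *s D = laplacian G *v f" by (simp only: real_divisor_inject)
    then show "int (nat \<bar>d\<bar>) *s D \<in> principal G" unfolding principal_def by blast
  qed
qed

section \<open>Principal divisors, divisor classes and finiteness of the Jacobian\<close>

lemma principal_zero: "0 \<in> principal G"
  using subgroup.one_closed[OF normal_imp_subgroup[OF normal_principal[of G]]]
  by (simp add: Div0_def)

lemma principal_add: "A \<in> principal G \<Longrightarrow> B \<in> principal G \<Longrightarrow> A + B \<in> principal G"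
  using subgroup.m_closed[OF normal_imp_subgroup[OF normal_principal[of G]]]
  by (simp add: Div0_def)

lemma principal_uminus: "A \<in> principal G \<Longrightarrow> - A \<in> principal G"
proof -
  assume "A \<in> principal G"
  then obtain f where "A = laplacian G *v f" unfolding principal_def by blast
  then have "- A = laplacian G *v (- f)"
    by (simp add: vec_eq_iff matrix_vector_mult_def sum_negf)
  then show ?thesis unfolding principal_def by blast
qed

lemma principal_diff: "A \<in> principal G \<Longrightarrow> B \<in> principal G \<Longrightarrow> A - B \<in> principal G"
  using principal_add[of A G "- B"] principal_uminus[of B G] by simp

lemma div_degree_principal: "A \<in> principal G \<Longrightarrow> div_degree A = 0"
  by (auto simp: principal_def degree_laplacian)

lemma jac_class_eq: "jac_class G D = (\<lambda>P. P + D) ` principal G"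
  by (auto simp: jac_class_def r_coset_def Div0_def)

lemma jac_class_eq_iff: "jac_class G D = jac_class G E \<longleftrightarrow> D - E \<in> principal G"
proof
  assume "jac_class G D = jac_class G E"
  moreover have "D \<in> jac_class G D"
    using principal_zero[of G] by (force simp: jac_class_eq)
  ultimately show "D - E \<in> principal G" by (auto simp: jac_class_eq)
next
  assume *: "D - E \<in> principal G"
  have sub: "jac_class G A \<subseteq> jac_class G B" if "A - B \<in> principal G" for A B
    using principal_add[OF _ that] by (force simp: jac_class_eq algebra_simps image_iff)
  show "jac_class G D = jac_class G E"
    using sub[OF *] sub[of E D] principal_uminus[OF *] by simp
qed

lemma div_degree_add: "div_degree (A + B) = div_degree A + div_degree B"
  by (simp add: div_degree_def sum.distrib)

lemma div_degree_diff: "div_degree (A - B) = div_degree A - div_degree B"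
  by (simp add: div_degree_def sum_subtractf)

lemma div_degree_smult: "div_degree (k *s A) = k * div_degree A"
  by (simp add: div_degree_def sum_distrib_left)

lemma div_degree_vertex_div: "div_degree (vertex_div v) = 1"
  by (simp add: div_degree_def vertex_div_def axis_def)

lemma div_degree_sum: "div_degree (\<Sum>i\<in>S. f i) = (\<Sum>i\<in>S. div_degree (f i))"
  unfolding div_degree_def by (simp add: sum.swap[of _ S])

lemma vec_smult_sum: "k *s (\<Sum>i\<in>S. f i) = (\<Sum>i\<in>S. k *s f i)" for k :: int
  by (simp add: vec_eq_iff sum_distrib_left)

text \<open>The classes of \<open>v - q\<close> generate the group and \<open>N\<close> annihilates
  it, so coefficients between 0 and \<open>N - 1\<close> reach every class.\<close>

lemma finite_carrier_Jac:
  assumes "connected_multigraph (G :: 'v::finite multigraph)"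
  shows "finite (carrier (Jac G))"
proof -
  obtain q :: 'v where True by simp
  obtain N where N: "0 < N" "\<And>D. div_degree D = 0 \<Longrightarrow> int N *s D \<in> principal G"
    using ex_exponent_Jac[OF assms] by metis
  define c where "c a = jac_class G (\<Sum>v\<in>UNIV. a v *s (vertex_div v - vertex_div q))"
    for a :: "'v \<Rightarrow> int"
  have "jac_class G D \<in> c ` (UNIV \<rightarrow>\<^sub>E {0..<int N})" if D: "div_degree D = 0" for D
  proof
    \<comment> \<open>Quotient and remainder of each coefficient modulo \<open>N\<close>:
      \<open>D\<close> differs from \<open>?X\<close> by \<open>N\<close> times the degree-0 divisor
      \<open>?Y\<close>, and such a multiple is principal.\<close>
    let ?X = "(\<Sum>v\<in>UNIV. (D $ v mod int N) *s (vertex_div v - vertex_div q))"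
    let ?Y = "(\<Sum>v\<in>UNIV. (D $ v div int N) *s (vertex_div v - vertex_div q))"
    have "D = ?X + int N *s ?Y"
    proof -
      have "(D $ v) *s B = (D $ v mod int N) *s B + int N *s ((D $ v div int N) *s B)" 
        for v and B :: "'v divisor"
        by (simp add: vec_eq_iff flip: mult.assoc distrib_right)
      then show ?thesis
        using divisor_decompose[OF D, of q]
        by (simp only: sum.distrib[symmetric] vec_smult_sum)
    qed
    moreover have "div_degree ?Y = 0"
      by (simp add: div_degree_sum div_degree_smult div_degree_diff div_degree_vertex_div)
    moreover have "D - A \<in> principal G" if "D = A + int N *s B" "div_degree B = 0" for A B
      using N(2)[OF that(2)] that(1) by simp
    ultimately have "D - ?X \<in> principal G" by blast
    then show "jac_class G D = c (\<lambda>v. D $ v mod int N)" by (simp add: c_def jac_class_eq_iff)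
    show "(\<lambda>v. D $ v mod int N) \<in> UNIV \<rightarrow>\<^sub>E {0..<int N}" using N(1) by auto
  qed
  then have "carrier (Jac G) \<subseteq> c ` (UNIV \<rightarrow>\<^sub>E {0..<int N})" by (auto simp: carrier_Jac)
  then show ?thesis by (rule finite_subset) (auto intro!: finite_imageI finite_PiE)
qed

section \<open>Characters of the Jacobian\<close>

lemma jac_dual_mult:
  assumes "phi \<in> jac_dual G" "div_degree A = 0" "div_degree B = 0"
  shows "phi (jac_class G (A + B)) = phi (jac_class G A) * phi (jac_class G B)"
  using assms hom_mult[of phi "Jac G" complex_units "jac_class G A" "jac_class G B"]
  by (simp add: jac_dual_def jac_class_add carrier_Jac complex_units_def)

lemma jac_dual_nonzero:
  assumes "phi \<in> jac_dual G" "div_degree A = 0"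
  shows "phi (jac_class G A) \<noteq> 0"
  using assms hom_in_carrier[of phi "Jac G" complex_units "jac_class G A"]
  by (auto simp: jac_dual_def carrier_Jac complex_units_def)

lemma jac_dual_zero:
  assumes "phi \<in> jac_dual G"
  shows "phi (jac_class G 0) = 1"
proof -
  have d: "div_degree 0 = 0" by (simp add: div_degree_def)
  show ?thesis using jac_dual_mult[OF assms d d] jac_dual_nonzero[OF assms d] by simp
qed

lemma jac_dual_diff:
  assumes "phi \<in> jac_dual G" "div_degree A = 0" "div_degree B = 0"
  shows "phi (jac_class G (A - B)) = phi (jac_class G A) / phi (jac_class G B)"
  using jac_dual_mult[OF assms(1), of "A - B" B] jac_dual_nonzero[OF assms(1), of B] assms
  by (simp add: div_degree_diff)

text \<open>Applied to \<open>B v = v - q\<close>, the right-hand side is the factor by which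
  \<open>rho\<close> scales a monomial with exponents \<open>m\<close>.\<close>

lemma jac_dual_sum:
  fixes m :: "'v::finite \<Rightarrow> nat"
  assumes phi: "phi \<in> jac_dual G" and B: "\<And>v. div_degree (B v) = 0"
  shows "phi (jac_class G (\<Sum>v\<in>S. int (m v) *s B v)) = (\<Prod>v\<in>S. phi (jac_class G (B v)) ^ m v)"
proof -
  have pow: "phi (jac_class G (int k *s B v)) = phi (jac_class G (B v)) ^ k" for k v
  proof (induction k)
    case 0
    then show ?case using jac_dual_zero[OF phi] by simp
  next
    case (Suc k)
    have "int (Suc k) *s B v = B v + int k *s B v" by (simp add: vec_eq_iff algebra_simps)
    then show ?case using Suc jac_dual_mult[OF phi B, of "int k *s B v" v] B
      by (simp add: div_degree_smult)
  qed
  have deg: "div_degree (\<Sum>v\<in>S. int (m v) *s B v) = 0" for S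
    by (simp add: div_degree_sum div_degree_smult B)
  show ?thesis
    using finite[of S]
  proof (induction S rule: finite_induct)
    case empty
    then show ?case using jac_dual_zero[OF phi] by simp
  next
    case (insert x F)
    then show ?case using jac_dual_mult[OF phi _ deg, of "int (m x) *s B x" F] B
      by (simp add: pow div_degree_smult)
  qed
qed

lemma cis_eq_one_iff: "cis (2 * pi * t) = 1 \<longleftrightarrow> t \<in> \<int>"
proof
  assume "cis (2 * pi * t) = 1"
  then have "cos (2 * pi * t) = 1" by (simp add: complex_eq_iff)
  then obtain k where "2 * pi * t = of_int k * (2 * pi)" by (auto simp: cos_one_2pi_int)
  then show "t \<in> \<int>" by simp
next
  assume "t \<in> \<int>"
  then show "cis (2 * pi * t) = 1" by (rule cis_multiple_2pi)
qed

text \<open>Pairing \<open>y\<close> with a principal divisor \<open>L f\<close> gives the pairing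
  of \<open>L y\<close> with \<open>f\<close>, an integer. The exponential is therefore trivial on
  principal divisors and descends to classes.\<close>

lemma ex_jac_dual_of_potential:
  assumes y: "\<And>v. (real_laplacian G *v y) $ v \<in> \<int>"
  obtains phi where "phi \<in> jac_dual G"
    "\<And>D. div_degree D = 0 \<Longrightarrow> phi (jac_class G D) = cis (2 * pi * (y \<bullet> real_divisor D))"
proof -
  define e where "e D = cis (2 * pi * (y \<bullet> real_divisor D))" for D
  have e_add: "e (A + B) = e A * e B" for A B
  proof -
    have "real_divisor (A + B) = real_divisor A + real_divisor B"
      by (simp add: real_divisor_def vec_eq_iff)
    then show ?thesis by (simp add: e_def inner_add_right distrib_left cis_mult)
  qed
  have e_prin: "e A = 1" if prin: "A \<in> principal G" for A
  proof -
    obtain f where "A = laplacian G *v f" using prin unfolding principal_def by blast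
    then have "y \<bullet> real_divisor A = (real_laplacian G *v y) \<bullet> real_divisor f"
      by (simp flip: real_laplacian_mult_real_divisor add: inner_real_laplacian)
    also have "\<dots> \<in> \<int>" unfolding inner_vec_def
      by (intro Ints_sum) (simp add: real_divisor_def y)
    finally show ?thesis by (simp add: e_def cis_eq_one_iff)
  qed
  have e_cong: "e A = e B" if "jac_class G A = jac_class G B" for A B
    using e_prin[of "A - B"] e_add[of "A - B" B] that by (simp add: jac_class_eq_iff)
  \<comment> \<open>A representative of the class is chosen arbitrarily; \<open>e_cong\<close> shows
    that the value does not depend on it.\<close>
  define phi where "phi = (\<lambda>c\<in>carrier (Jac G). e (SOME D. c = jac_class G D))"
  have phi: "phi (jac_class G D) = e D" if "div_degree D = 0" for D
  proof -
    have "jac_class G D = jac_class G (SOME E. jac_class G D = jac_class G E)"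
      by (rule someI) (rule refl)
    from e_cong[OF this] have "e (SOME E. jac_class G D = jac_class G E) = e D" by (rule sym)
    moreover have "jac_class G D \<in> carrier (Jac G)" using that by (auto simp: carrier_Jac)
    ultimately show ?thesis by (simp add: phi_def)
  qed
  have "phi \<in> hom (Jac G) complex_units"
  proof (rule homI)
    fix x assume "x \<in> carrier (Jac G)"
    then show "phi x \<in> carrier complex_units"
      using phi by (auto simp: carrier_Jac complex_units_def e_def)
  next
    fix x y assume "x \<in> carrier (Jac G)" "y \<in> carrier (Jac G)"
    then obtain A B where "x = jac_class G A" "y = jac_class G B"
      and d: "div_degree A = 0" "div_degree B = 0" by (auto simp: carrier_Jac)
    then show "phi (x \<otimes>\<^bsub>Jac G\<^esub> y) = phi x \<otimes>\<^bsub>complex_units\<^esub> phi y"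
      using phi d phi[of "A + B"]
      by (simp add: jac_class_add[symmetric] div_degree_add e_add complex_units_def)
  qed
  then have "phi \<in> jac_dual G" by (simp add: jac_dual_def phi_def)
  with phi that show ?thesis by (simp add: e_def)
qed

text \<open>
  If \<open>L g = D\<close> and \<open>L y = u - q\<close> over the reals, then self-adjointness gives
  \<open>\<langle>y, D\<rangle> = g(u) - g(q)\<close>. So the characters with potentials \<open>y\<close> detect whether \<open>g\<close> is integral,
  i.e. whether \<open>D\<close> is principal.
\<close>

lemma jac_dual_separates:
  assumes conn: "connected_multigraph G" and D: "div_degree D = 0"
    and triv: "\<And>phi. phi \<in> jac_dual G \<Longrightarrow> phi (jac_class G D) = 1"
  shows "D \<in> principal G"
proof -
  fix q
  have "(\<Sum>v\<in>UNIV. real_divisor D $ v) = 0" using D by (simp add: sum_real_divisor)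
  \<comment> \<open>With \<open>g\<close> normalised to 0 at \<open>q\<close>, the difference
    \<open>g(u) - g(q)\<close> detected by a character is \<open>g(u)\<close> itself.\<close>
  then obtain g where g: "real_laplacian G *v g = real_divisor D" "g $ q = 0"
    using ex_real_laplacian_preimage[OF conn] by metis
  have "g $ u \<in> \<int>" for u
  proof -
    define b :: "real ^ 'a" where "b = axis u 1 - axis q 1"
    have "(\<Sum>v\<in>UNIV. b $ v) = 0" by (simp add: b_def sum_subtractf) (simp add: axis_def)
    then obtain y where y: "real_laplacian G *v y = b"
      using ex_real_laplacian_preimage[OF conn] by metis
    have "b $ v \<in> \<int>" for v by (simp add: b_def axis_def)
    then obtain phi where phi: "phi \<in> jac_dual G"
      "phi (jac_class G D) = cis (2 * pi * (y \<bullet> real_divisor D))"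
      using ex_jac_dual_of_potential[of G y] y D by metis
    have "y \<bullet> real_divisor D \<in> \<int>"
      using triv[OF phi(1)] unfolding phi(2) cis_eq_one_iff .
    moreover have "y \<bullet> real_divisor D = g $ u"
      using g inner_real_laplacian[of y G g] y
      by (simp add: b_def inner_diff_left inner_axis')
    ultimately show ?thesis by simp
  qed
  then obtain f where "g = real_divisor f" using real_divisorE by metis
  then have "D = laplacian G *v f"
    using g real_divisor_inject by (metis real_laplacian_mult_real_divisor)
  then show ?thesis by (simp add: principal_def)
qed

subsection \<open>Polynomials with prescribed support\<close>

lemma lookup_scale_poly [simp]:
  "Poly_Mapping.lookup (scale_poly c f) m = c * Poly_Mapping.lookup f m"
  by (simp add: scale_poly_def const_poly_def flip: mult_map_scale_conv_mult)
    (simp add: Poly_Mapping.map.rep_eq when_def)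

lemma scale_poly_single: "scale_poly c (Poly_Mapping.single m d) = Poly_Mapping.single m (c * d)"
  by (simp add: scale_poly_def const_poly_def mult_single)

lemma poly_mapping_sum_singles:
  "f = (\<Sum>m\<in>Poly_Mapping.keys f. Poly_Mapping.single m (Poly_Mapping.lookup f m))"
  by (rule poly_mapping_eqI) (simp add: lookup_sum lookup_single when_def in_keys_iff)

abbreviation monom_exp :: "('v \<Rightarrow>\<^sub>0 nat) \<Rightarrow> 'v cpoly" where
  "monom_exp m \<equiv> Poly_Mapping.single m 1"

lemma lookup_times_monom_exp:
  "Poly_Mapping.lookup (f * monom_exp r) (k + r) = Poly_Mapping.lookup f k"
proof -
  have "f * monom_exp r =
      (\<Sum>m\<in>Poly_Mapping.keys f. Poly_Mapping.single (m + r) (Poly_Mapping.lookup f m))"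
    by (subst poly_mapping_sum_singles[of f]) (simp add: sum_distrib_right mult_single)
  then show ?thesis by (simp add: lookup_sum lookup_single when_def in_keys_iff)
qed

lemma keys_times_monom_exp:
  "Poly_Mapping.keys (f * monom_exp r) \<subseteq> (\<lambda>k. k + r) ` Poly_Mapping.keys f"
  using keys_mult[of f "monom_exp r"] by auto

lemma inj_monom_exp: "inj (monom_exp :: ('v \<Rightarrow>\<^sub>0 nat) \<Rightarrow> 'v cpoly)"
  by (rule injI) (metis lookup_single_eq lookup_single_not_eq zero_neq_one)

text \<open>Distinct members of \<open>Q\<close> are distinct monomials, so no cancellation occurs
  and each coefficient can be read off.\<close>

lemma lookup_sum_scale_monomials:
  assumes "finite Q" "Q \<subseteq> range monom_exp"
  shows "Poly_Mapping.lookup (\<Sum>b\<in>Q. scale_poly (a b) b) m =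
    (if monom_exp m \<in> Q then a (monom_exp m) else 0)"
proof -
  have "Poly_Mapping.lookup (\<Sum>b\<in>Q. scale_poly (a b) b) m =
      (\<Sum>b\<in>Q. if b = monom_exp m then a b else 0)"
    unfolding lookup_sum
  proof (rule sum.cong[OF refl])
    fix b assume "b \<in> Q"
    then obtain r where "b = monom_exp r" using assms(2) by auto
    then show "Poly_Mapping.lookup (scale_poly (a b) b) m = (if b = monom_exp m then a b else 0)"
      using injD[OF inj_monom_exp, of r m] by (auto simp: lookup_single when_def)
  qed
  then show ?thesis using assms(1) by simp
qed

text \<open>The exponent of the product of the monomials with exponents \<open>g v\<close>, each
  raised to the power \<open>k v\<close>; the inner sum is the \<open>k v\<close>-fold multiple of
  \<open>g v\<close>.\<close>

definition exp_comb :: "('v::finite \<Rightarrow> 'w \<Rightarrow>\<^sub>0 nat) \<Rightarrow> ('v \<Rightarrow> nat) \<Rightarrow> 'w \<Rightarrow>\<^sub>0 nat" where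
  "exp_comb g k = (\<Sum>v\<in>UNIV. \<Sum>i<k v. g v)"

lemma lookup_exp_comb:
  "Poly_Mapping.lookup (exp_comb g k) u = (\<Sum>v\<in>UNIV. k v * Poly_Mapping.lookup (g v) u)"
  by (simp add: exp_comb_def lookup_sum)

lemma power_single:
  "Poly_Mapping.single m c ^ k = Poly_Mapping.single (\<Sum>i<k. m) (c ^ k)" for c :: complex
  by (induction k) (simp_all add: mult_single add.commute flip: single_one)

lemma prod_single:
  "(\<Prod>v\<in>S. Poly_Mapping.single (g v) (c v)) = Poly_Mapping.single (\<Sum>v\<in>S. g v) (\<Prod>v\<in>S. c v)"
  if "finite S" for c :: "'v \<Rightarrow> complex"
  using that by (induction S) (simp_all add: mult_single)

lemma prod_single_power:
  "(\<Prod>v\<in>UNIV. Poly_Mapping.single (g v) (c v) ^ k v) =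
    Poly_Mapping.single (exp_comb g k) (\<Prod>v\<in>UNIV. c v ^ k v)" for c :: "'v::finite \<Rightarrow> complex"
  by (simp add: power_single prod_single exp_comb_def)

lemma subst_poly_single:
  "subst_poly (\<lambda>v. Poly_Mapping.single (g v) (c v)) f =
    (\<Sum>m\<in>Poly_Mapping.keys f. Poly_Mapping.single (exp_comb g (Poly_Mapping.lookup m))
       (Poly_Mapping.lookup f m * (\<Prod>v\<in>UNIV. c v ^ Poly_Mapping.lookup m v)))"
  by (simp add: subst_poly_def prod_single_power scale_poly_single)

lemma exp_comb_singles: "exp_comb (\<lambda>v. Poly_Mapping.single v 1) (Poly_Mapping.lookup m) = m"
  by (rule poly_mapping_eqI)
    (simp add: lookup_exp_comb lookup_single when_def if_distrib[of "\<lambda>x. _ * x"] cong: if_cong)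

lemma lookup_compose_matrix_diagonal:
  assumes "\<And>v w. A $ v $ w = (if v = w then d v else 0)"
  shows "Poly_Mapping.lookup (compose_matrix f A) m =
    Poly_Mapping.lookup f m * (\<Prod>v\<in>UNIV. d v ^ Poly_Mapping.lookup m v)"
proof -
  have "(\<Sum>w\<in>UNIV. scale_poly (A $ v $ w) (var_poly w)) =
      Poly_Mapping.single (Poly_Mapping.single v 1) (d v)" for v
  proof -
    have "(\<Sum>w\<in>UNIV. scale_poly (A $ v $ w) (var_poly w)) =
        (\<Sum>w\<in>UNIV. if w = v then scale_poly (d v) (var_poly v) else 0)"
      by (rule sum.cong) (auto simp: assms)
    then show ?thesis by (simp add: var_poly_def scale_poly_single)
  qed
  then have "compose_matrix f A = (\<Sum>m\<in>Poly_Mapping.keys f. Poly_Mapping.single m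
       (Poly_Mapping.lookup f m * (\<Prod>v\<in>UNIV. d v ^ Poly_Mapping.lookup m v)))"
    by (simp add: compose_matrix_def subst_poly_single exp_comb_singles[unfolded One_nat_def])
  then show ?thesis by (simp add: lookup_sum lookup_single when_def in_keys_iff)
qed

section \<open>Effective divisors, exponent vectors and monomials\<close>

definition exp_divisor :: "('v::finite \<Rightarrow>\<^sub>0 nat) \<Rightarrow> 'v divisor" where
  "exp_divisor m = (\<chi> v. int (Poly_Mapping.lookup m v))"

lemma effective_exp_divisor: "effective (exp_divisor m)"
  by (simp add: effective_def exp_divisor_def)

lemma Collect_effective: "{E. effective E} = range exp_divisor"
proof -
  have "E \<in> range exp_divisor" if "effective E" for E :: "'v::finite divisor"
  proof
    show "E = exp_divisor (Abs_poly_mapping (\<lambda>v. nat (E $ v)))"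
      using that by (simp add: exp_divisor_def effective_def vec_eq_iff)
  qed simp
  then show ?thesis using effective_exp_divisor by auto
qed

lemma div_monomial_exp_divisor: "div_monomial (exp_divisor m) = monom_exp m"
  by (simp add: div_monomial_def var_poly_def prod_single_power exp_divisor_def
      exp_comb_singles[unfolded One_nat_def])

lemma div_monomial_image_exp_divisor: "div_monomial ` exp_divisor ` A = monom_exp ` A"
  by (simp add: image_image div_monomial_exp_divisor)

lemma monomials_eq: "monomials = range monom_exp"
  by (simp add: monomials_def Collect_effective div_monomial_image_exp_divisor)

lemma inj_on_div_monomial: "inj_on div_monomial {E. effective E}"
  unfolding Collect_effective
  by (rule inj_onI) (auto simp: div_monomial_exp_divisor dest: injD[OF inj_monom_exp])

lemma homogeneous_monom_exp: "homogeneous_poly (monom_exp m)"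
  by (simp add: homogeneous_poly_def)

text \<open>All invariant spaces and the ideals below turn out to have this shape, so questions
  about them become questions about sets of exponents.\<close>

definition polys_on :: "('v \<Rightarrow>\<^sub>0 nat) set \<Rightarrow> 'v cpoly set" where
  "polys_on A = {f. Poly_Mapping.keys f \<subseteq> A}"

lemma polys_on_lookup: "f \<in> polys_on A \<Longrightarrow> m \<notin> A \<Longrightarrow> Poly_Mapping.lookup f m = 0"
  by (auto simp: polys_on_def in_keys_iff)

lemma polys_onI: "(\<And>m. m \<notin> A \<Longrightarrow> Poly_Mapping.lookup f m = 0) \<Longrightarrow> f \<in> polys_on A"
  by (auto simp: polys_on_def in_keys_iff)

lemma monom_exp_in_polys_on: "monom_exp m \<in> polys_on A \<longleftrightarrow> m \<in> A"
  by (simp add: polys_on_def)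

lemma polys_on_sum: "(\<And>i. i \<in> S \<Longrightarrow> f i \<in> polys_on A) \<Longrightarrow> (\<Sum>i\<in>S. f i) \<in> polys_on A"
  by (rule polys_onI) (auto simp: lookup_sum intro!: sum.neutral polys_on_lookup)

lemma subspace_polys_on: "cpoly.subspace (polys_on A)"
  by (rule cpoly.subspaceI) (auto intro!: polys_onI simp: lookup_add polys_on_lookup)

lemma span_monom_exp: "cpoly.span (monom_exp ` A) = polys_on A"
proof
  show "cpoly.span (monom_exp ` A) \<subseteq> polys_on A"
    by (rule cpoly.span_minimal) (auto simp: subspace_polys_on monom_exp_in_polys_on)
  show "polys_on A \<subseteq> cpoly.span (monom_exp ` A)"
  proof
    fix f assume f: "f \<in> polys_on A"
    have "(\<Sum>m\<in>Poly_Mapping.keys f. scale_poly (Poly_Mapping.lookup f m) (monom_exp m))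
        \<in> cpoly.span (monom_exp ` A)"
      by (intro cpoly.span_sum cpoly.span_scale cpoly.span_base)
        (use f in \<open>auto simp: polys_on_def\<close>)
    then show "f \<in> cpoly.span (monom_exp ` A)"
      using poly_mapping_sum_singles[of f] by (simp add: scale_poly_single)
  qed
qed

lemma independent_monom_exp: "cpoly.independent (monom_exp ` A)"
proof
  assume "cpoly.dependent (monom_exp ` A)"
  then obtain t a b where t: "finite t" "t \<subseteq> monom_exp ` A"
    and 0: "(\<Sum>v\<in>t. scale_poly (a v) v) = 0" and b: "b \<in> t" "a b \<noteq> 0"
    unfolding cpoly.dependent_explicit by blast
  obtain m where m: "b = monom_exp m" using t b by auto
  have "t \<subseteq> range monom_exp" using t by auto
  from lookup_sum_scale_monomials[OF t(1) this, of a m] show False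
    using 0 b m by simp
qed

definition poly_restrict :: "('v \<Rightarrow>\<^sub>0 nat) set \<Rightarrow> 'v cpoly \<Rightarrow> 'v cpoly" where
  "poly_restrict A f =
     (\<Sum>m\<in>Poly_Mapping.keys f \<inter> A. Poly_Mapping.single m (Poly_Mapping.lookup f m))"

lemma lookup_poly_restrict:
  "Poly_Mapping.lookup (poly_restrict A f) m = (if m \<in> A then Poly_Mapping.lookup f m else 0)"
  by (simp add: poly_restrict_def lookup_sum lookup_single when_def in_keys_iff)

lemma poly_restrict_in_polys_on: "poly_restrict A f \<in> polys_on A"
  by (rule polys_onI) (simp add: lookup_poly_restrict)

text \<open>The quotient has the monomials with exponents in \<open>C - T\<close> as a basis. A
  monomial from \<open>T\<close> in \<open>Q\<close> would be zero in the quotient and break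
  uniqueness; one from \<open>C - T\<close> missing in \<open>Q\<close> would not be
  representable.\<close>

lemma basis_modulo_polys_on_iff:
  assumes "T \<subseteq> C" "finite (C - T)" "Q \<subseteq> range monom_exp"
  shows "basis_modulo Q (polys_on C) (polys_on T) \<longleftrightarrow> Q = monom_exp ` (C - T)"
proof
  assume bas: "basis_modulo Q (polys_on C) (polys_on T)"
  have fin: "finite Q" and QC: "Q \<subseteq> polys_on C"
    and ex1: "\<And>f. f \<in> polys_on C \<Longrightarrow>
      \<exists>!a. a \<in> (Q \<rightarrow>\<^sub>E UNIV) \<and> f - (\<Sum>b\<in>Q. scale_poly (a b) b) \<in> polys_on T"
    using bas by (auto simp: basis_modulo_def)
  note lk = lookup_sum_scale_monomials[OF fin assms(3)]
  show "Q = monom_exp ` (C - T)"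
  proof
    show "Q \<subseteq> monom_exp ` (C - T)"
    proof
      fix b assume b: "b \<in> Q"
      then obtain m where m: "b = monom_exp m" using assms(3) by auto
      have "m \<in> C" using QC b m by (auto simp: monom_exp_in_polys_on)
      moreover have False if "m \<in> T"
      proof -
        \<comment> \<open>Two different representations of 0 modulo \<open>polys_on T\<close>: all
          coefficients zero, and coefficient 1 at the offending monomial \<open>b\<close>.\<close>
        let ?a = "\<lambda>x\<in>Q. 0 :: complex" and ?a' = "\<lambda>x\<in>Q. if x = b then 1 else 0 :: complex"
        have "0 - (\<Sum>x\<in>Q. scale_poly (?a x) x) \<in> polys_on T"
          by (rule polys_onI) (simp add: lookup_minus lk)
        moreover have "0 - (\<Sum>x\<in>Q. scale_poly (?a' x) x) \<in> polys_on T"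
          by (rule polys_onI)
            (use that m in \<open>auto simp: lookup_minus lk dest: injD[OF inj_monom_exp]\<close>)
        moreover have "(0 :: 'a cpoly) \<in> polys_on C" by (simp add: polys_on_def)
        ultimately have "?a = ?a'" using ex1[of 0] by auto
        then have "?a b = ?a' b" by (rule fun_cong)
        then show False using b by simp
      qed
      ultimately show "b \<in> monom_exp ` (C - T)" using m by auto
    qed
    show "monom_exp ` (C - T) \<subseteq> Q"
    proof
      fix b assume "b \<in> monom_exp ` (C - T)"
      then obtain m where m: "b = monom_exp m" "m \<in> C" "m \<notin> T" by auto
      then obtain a where "b - (\<Sum>x\<in>Q. scale_poly (a x) x) \<in> polys_on T"
        using ex1[of b] by (auto simp: monom_exp_in_polys_on)
      from polys_on_lookup[OF this m(3)] show "b \<in> Q"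
        using m(1) by (auto simp: lookup_minus lk split: if_splits)
    qed
  qed
next
  assume Q: "Q = monom_exp ` (C - T)"
  have fin: "finite Q" using Q assms(2) by simp
  note lk = lookup_sum_scale_monomials[OF fin assms(3)]
  have inQ: "monom_exp m \<in> Q \<longleftrightarrow> m \<in> C - T" for m
    unfolding Q by (rule inj_image_mem_iff[OF inj_monom_exp])
  show "basis_modulo Q (polys_on C) (polys_on T)"
    unfolding basis_modulo_def
  proof (intro conjI ballI fin)
    show "Q \<subseteq> polys_on C" using Q by (auto simp: monom_exp_in_polys_on)
    fix f assume f: "f \<in> polys_on C"
    have iff: "f - (\<Sum>b\<in>Q. scale_poly (a b) b) \<in> polys_on T \<longleftrightarrow>
        (\<forall>m\<in>C - T. a (monom_exp m) = Poly_Mapping.lookup f m)" for a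
    proof
      assume "f - (\<Sum>b\<in>Q. scale_poly (a b) b) \<in> polys_on T"
      then show "\<forall>m\<in>C - T. a (monom_exp m) = Poly_Mapping.lookup f m"
        using polys_on_lookup inQ by (fastforce simp: lookup_minus lk)
    next
      assume "\<forall>m\<in>C - T. a (monom_exp m) = Poly_Mapping.lookup f m"
      then show "f - (\<Sum>b\<in>Q. scale_poly (a b) b) \<in> polys_on T"
        using inQ polys_on_lookup[OF f] by (intro polys_onI) (auto simp: lookup_minus lk)
    qed
    \<comment> \<open>By \<open>iff\<close> the coefficients have to be those of \<open>f\<close>;
      the exponent is recovered from the monomial by \<open>inv_into\<close>.\<close>
    define a0 where "a0 = (\<lambda>b\<in>Q. Poly_Mapping.lookup f (inv_into UNIV monom_exp b))"
    have a0: "a0 (monom_exp m) = Poly_Mapping.lookup f m" if "m \<in> C - T" for m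
      using that inQ by (simp add: a0_def inv_f_f[OF inj_monom_exp])
    show "\<exists>!a. a \<in> (Q \<rightarrow>\<^sub>E UNIV) \<and> f - (\<Sum>b\<in>Q. scale_poly (a b) b) \<in> polys_on T"
    proof (rule ex1I[of _ a0])
      show "a0 \<in> (Q \<rightarrow>\<^sub>E UNIV) \<and> f - (\<Sum>b\<in>Q. scale_poly (a0 b) b) \<in> polys_on T"
        using a0 unfolding iff by (auto simp: a0_def)
      fix a assume a: "a \<in> (Q \<rightarrow>\<^sub>E UNIV) \<and> f - (\<Sum>b\<in>Q. scale_poly (a b) b) \<in> polys_on T"
      show "a = a0"
      proof
        fix b
        show "a b = a0 b"
        proof (cases "b \<in> Q")
          case True
          then obtain m where "b = monom_exp m" "m \<in> C - T" unfolding Q by blast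
          then show ?thesis using a a0 unfolding iff by simp
        next
          case False
          then show ?thesis using a by (auto simp: a0_def)
        qed
      qed
    qed
  qed
qed

subsection \<open>Relative invariants of the Jacobian\<close>

text \<open>This is the divisor of \<open>m\<close> moved to degree 0 by subtracting a multiple of
  \<open>q\<close>, see \<open>class_divisor_eq\<close>. Expanding it in the generators
  \<open>v - q\<close> lets characters evaluate it as a product.\<close>

definition class_divisor :: "'v::finite \<Rightarrow> ('v \<Rightarrow>\<^sub>0 nat) \<Rightarrow> 'v divisor" where
  "class_divisor q m = (\<Sum>v\<in>UNIV. int (Poly_Mapping.lookup m v) *s (vertex_div v - vertex_div q))"

lemma div_degree_vertex_diff: "div_degree (vertex_div v - vertex_div q) = 0"
  by (simp add: div_degree_diff div_degree_vertex_div)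

lemma div_degree_class_divisor: "div_degree (class_divisor q m) = 0"
  by (simp add: class_divisor_def div_degree_sum div_degree_smult div_degree_vertex_diff
      del: vector_ssub_ldistrib)

lemma class_divisor_add: "class_divisor q (m + k) = class_divisor q m + class_divisor q k"
  by (simp add: class_divisor_def vec_eq_iff lookup_add distrib_right sum.distrib
      del: vector_ssub_ldistrib vector_minus_component)

lemma class_divisor_single:
  "class_divisor q (Poly_Mapping.single v k) = int k *s (vertex_div v - vertex_div q)"
proof -
  have "class_divisor q (Poly_Mapping.single v k) =
      (\<Sum>u\<in>UNIV. if u = v then int k *s (vertex_div v - vertex_div q) else 0)"
    unfolding class_divisor_def by (rule sum.cong) (auto simp: lookup_single when_def)
  then show ?thesis by simp
qed

lemma class_divisor_eq:
  "class_divisor q m = exp_divisor m - div_degree (exp_divisor m) *s vertex_div q"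
proof -
  let ?E = "exp_divisor m - div_degree (exp_divisor m) *s vertex_div q"
  have "?E = (\<Sum>v\<in>UNIV. ?E $ v *s (vertex_div v - vertex_div q))"
    by (rule divisor_decompose) (simp add: div_degree_diff div_degree_smult div_degree_vertex_div)
  also have "\<dots> = class_divisor q m"
    unfolding class_divisor_def
    \<comment> \<open>The coefficients agree away from \<open>q\<close>, and at \<open>q\<close> the
      generator \<open>q - q\<close> is zero.\<close>
    by (rule sum.cong) (auto simp: exp_divisor_def vertex_div_def axis_def)
  finally show ?thesis by simp
qed

lemma principal_smult: "A \<in> principal G \<Longrightarrow> k *s A \<in> principal G"
proof -
  assume "A \<in> principal G"
  then obtain f where "A = laplacian G *v f" unfolding principal_def by blast
  then have "k *s A = laplacian G *v (k *s f)"
    by (simp add: vec_eq_iff matrix_vector_mult_def sum_distrib_left algebra_simps)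
  then show ?thesis unfolding principal_def by blast
qed

lemma principal_sum: "(\<And>i. i \<in> S \<Longrightarrow> f i \<in> principal G) \<Longrightarrow> (\<Sum>i\<in>S. f i) \<in> principal G"
  by (induction S rule: infinite_finite_induct) (simp_all add: principal_zero principal_add)

definition class_exps :: "'v::finite multigraph \<Rightarrow> 'v \<Rightarrow> 'v divisor \<Rightarrow> ('v \<Rightarrow>\<^sub>0 nat) set" where
  "class_exps G q D = {m. class_divisor q m - D \<in> principal G}"

lemma class_exps_iff_jac_class:
  "m \<in> class_exps G q D \<longleftrightarrow> jac_class G (class_divisor q m) = jac_class G D"
  by (simp add: class_exps_def jac_class_eq_iff)

text \<open>Invariant exponents have trivial class, so adding them never changes the class. Both
  directions matter: the set is also closed under cancelling an invariant factor.\<close>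

lemma class_exps_add_iff:
  assumes "k \<in> class_exps G q 0"
  shows "m + k \<in> class_exps G q D \<longleftrightarrow> m \<in> class_exps G q D"
proof
  assume "m + k \<in> class_exps G q D"
  with assms show "m \<in> class_exps G q D"
    using principal_diff[of "class_divisor q (m + k) - D" G "class_divisor q k"]
    by (simp add: class_exps_def class_divisor_add algebra_simps)
next
  assume "m \<in> class_exps G q D"
  with assms show "m + k \<in> class_exps G q D"
    using principal_add[of "class_divisor q m - D" G "class_divisor q k"]
    by (simp add: class_exps_def class_divisor_add algebra_simps)
qed

text \<open>Principal divisors have degree 0, so \<open>k\<close> is forced to be the degree of
  \<open>E\<close>; the union over \<open>k\<close> collapses to a single congruence in degree
  0.\<close>

lemma effective_class_eq:
  assumes D: "div_degree D = 0"
  shows "effective_class G q D = exp_divisor ` class_exps G q D"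
proof (intro equalityI subsetI)
  fix E assume "E \<in> effective_class G q D"
  then obtain k where k: "effective E" "E - (D + int k *s vertex_div q) \<in> principal G"
    by (auto simp: effective_class_def linear_system_def lin_equiv_def)
  then obtain m where m: "E = exp_divisor m" using Collect_effective by blast
  have "div_degree E = int k" using div_degree_principal[OF k(2)] D
    by (simp add: div_degree_diff div_degree_add div_degree_smult div_degree_vertex_div)
  then have "class_divisor q m - D = E - (D + int k *s vertex_div q)"
    by (simp add: class_divisor_eq m)
  then have "m \<in> class_exps G q D" using k(2) unfolding class_exps_def by (simp only: mem_Collect_eq)
  then show "E \<in> exp_divisor ` class_exps G q D" using m by blast
next
  fix E assume "E \<in> exp_divisor ` class_exps G q D"
  then obtain m where m: "E = exp_divisor m" "class_divisor q m - D \<in> principal G"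
    by (auto simp: class_exps_def)
  have "div_degree E \<ge> 0" by (simp add: m div_degree_def exp_divisor_def sum_nonneg)
  then have "E - (D + int (nat (div_degree E)) *s vertex_div q) \<in> principal G"
    using m by (simp add: class_divisor_eq algebra_simps)
  then show "E \<in> effective_class G q D"
    using m(1) effective_exp_divisor unfolding effective_class_def linear_system_def lin_equiv_def
    by blast
qed

lemma lookup_compose_rho:
  assumes phi: "phi \<in> jac_dual G"
  shows "Poly_Mapping.lookup (compose_matrix f (rho G q phi)) m =
    Poly_Mapping.lookup f m * phi (jac_class G (class_divisor q m))"
proof -
  have "Poly_Mapping.lookup (compose_matrix f (rho G q phi)) m = Poly_Mapping.lookup f m *
     (\<Prod>v\<in>UNIV. phi (jac_class G (vertex_div v - vertex_div q)) ^ Poly_Mapping.lookup m v)"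
    by (rule lookup_compose_matrix_diagonal) (auto simp: rho_def jac_dual_zero[OF phi])
  then show ?thesis
    unfolding class_divisor_def
    by (simp add: jac_dual_sum[OF phi div_degree_vertex_diff] del: vector_ssub_ldistrib)
qed

text \<open>Comparing coefficients, \<open>m\<close> may occur exactly when every character takes
  equal values at its class and at that of \<open>D\<close>. Separation of points turns this into
  equality of classes.\<close>

lemma rel_invariants_eq:
  assumes conn: "connected_multigraph G" and D: "div_degree D = 0"
  shows "rel_invariants (Jac_Gamma G q) (jac_char G q (jac_class G D)) =
    polys_on (class_exps G q D)"
proof -
  have sep: "m \<in> class_exps G q D \<longleftrightarrow>
      (\<forall>phi\<in>jac_dual G. phi (jac_class G (class_divisor q m)) = phi (jac_class G D))" for m
  proof
    assume *: "\<forall>phi\<in>jac_dual G. phi (jac_class G (class_divisor q m)) = phi (jac_class G D)"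
    have "class_divisor q m - D \<in> principal G"
    proof (rule jac_dual_separates[OF conn])
      show "div_degree (class_divisor q m - D) = 0"
        using D by (simp add: div_degree_diff div_degree_class_divisor)
      show "phi (jac_class G (class_divisor q m - D)) = 1" if "phi \<in> jac_dual G" for phi
        using * that D jac_dual_nonzero[OF that D]
        by (simp add: jac_dual_diff div_degree_class_divisor)
    qed
    then show "m \<in> class_exps G q D" by (simp add: class_exps_def)
  qed (simp add: class_exps_iff_jac_class)
  have "f \<in> rel_invariants (Jac_Gamma G q) (jac_char G q (jac_class G D)) \<longleftrightarrow>
      (\<forall>phi\<in>jac_dual G. \<forall>m. Poly_Mapping.lookup f m * phi (jac_class G (class_divisor q m)) =
         phi (jac_class G D) * Poly_Mapping.lookup f m)" for f
    by (auto simp: rel_invariants_def Jac_Gamma_def jac_char_rho poly_mapping_eq_iff fun_eq_iff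
        lookup_compose_rho)
  then show ?thesis
    by (auto simp: set_eq_iff polys_on_def in_keys_iff sep subset_eq)
qed

text \<open>On \<open>Jac_Gamma G q\<close> the trivial character is the one given by the zero
  class.\<close>

lemma invariants_eq:
  assumes "connected_multigraph G"
  shows "invariants (Jac_Gamma G q) = polys_on (class_exps G q 0)"
proof -
  have "invariants (Jac_Gamma G q) = rel_invariants (Jac_Gamma G q) (jac_char G q (jac_class G 0))"
    by (auto simp: rel_invariants_def Jac_Gamma_def jac_char_rho jac_dual_zero)
  then show ?thesis using rel_invariants_eq[OF assms, of 0] by (simp add: div_degree_def)
qed

text \<open>Every exponent belongs to exactly one class, so the components of \<open>f\<close> must
  be its restrictions to the classes.\<close>

lemma ex1_decomposition:
  fixes G :: "'v::finite multigraph" and f :: "'v cpoly"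
  assumes conn: "connected_multigraph G"
  shows "\<exists>!h. h \<in> (\<Pi>\<^sub>E c\<in>carrier (Jac G). rel_invariants (Jac_Gamma G q) (jac_char G q c)) \<and>
        f = (\<Sum>c\<in>carrier (Jac G). h c)"
proof -
  define cls where "cls m = jac_class G (class_divisor q m)" for m
  have fin: "finite (carrier (Jac G))" by (rule finite_carrier_Jac[OF conn])
  have inv: "rel_invariants (Jac_Gamma G q) (jac_char G q c) = polys_on {m. cls m = c}"
    if c: "c \<in> carrier (Jac G)" for c
  proof -
    obtain D where "c = jac_class G D" "div_degree D = 0" using c unfolding carrier_Jac by blast
    then show ?thesis
      by (simp add: rel_invariants_eq[OF conn] class_exps_iff_jac_class cls_def
          polys_on_def subset_eq)
  qed
  have cls: "cls m \<in> carrier (Jac G)" for m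
    by (auto simp: carrier_Jac cls_def div_degree_class_divisor)
  define h0 where "h0 = (\<lambda>c\<in>carrier (Jac G). poly_restrict {m. cls m = c} f)"
  show ?thesis
  proof (rule ex1I[of _ h0])
    have "f = (\<Sum>c\<in>carrier (Jac G). h0 c)"
    proof (rule poly_mapping_eqI)
      fix m
      have "Poly_Mapping.lookup (\<Sum>c\<in>carrier (Jac G). h0 c) m =
          (\<Sum>c\<in>carrier (Jac G). if cls m = c then Poly_Mapping.lookup f m else 0)"
        unfolding lookup_sum by (rule sum.cong) (auto simp: h0_def lookup_poly_restrict)
      then show "Poly_Mapping.lookup f m = Poly_Mapping.lookup (\<Sum>c\<in>carrier (Jac G). h0 c) m"
        using fin cls[of m] by simp
    qed
    moreover have "h0 \<in> (\<Pi>\<^sub>E c\<in>carrier (Jac G). rel_invariants (Jac_Gamma G q) (jac_char G q c))"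
      by (auto simp: h0_def inv poly_restrict_in_polys_on)
    ultimately show "h0 \<in> (\<Pi>\<^sub>E c\<in>carrier (Jac G). rel_invariants (Jac_Gamma G q) (jac_char G q c)) \<and>
      f = (\<Sum>c\<in>carrier (Jac G). h0 c)" by simp
  next
    fix h
    assume "h \<in> (\<Pi>\<^sub>E c\<in>carrier (Jac G). rel_invariants (Jac_Gamma G q) (jac_char G q c)) \<and>
      f = (\<Sum>c\<in>carrier (Jac G). h c)"
    then have h: "h \<in> (\<Pi>\<^sub>E c\<in>carrier (Jac G). rel_invariants (Jac_Gamma G q) (jac_char G q c))"
      and f: "f = (\<Sum>c\<in>carrier (Jac G). h c)" by auto
    have 0: "Poly_Mapping.lookup (h c) m = 0" if "c \<in> carrier (Jac G)" "cls m \<noteq> c" for c m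
      using PiE_mem[OF h that(1)] that polys_on_lookup[of "h c" "{m. cls m = c}" m]
      by (simp add: inv)
    \<comment> \<open>Only the component indexed by the class of \<open>m\<close> can contribute to
      the coefficient at \<open>m\<close>.\<close>
    have fh: "Poly_Mapping.lookup f m = Poly_Mapping.lookup (h (cls m)) m" for m
    proof -
      have "Poly_Mapping.lookup f m =
          (\<Sum>c\<in>carrier (Jac G). if c = cls m then Poly_Mapping.lookup (h (cls m)) m else 0)"
        unfolding f lookup_sum by (rule sum.cong) (auto simp: 0)
      then show ?thesis using fin cls[of m] by simp
    qed
    show "h = h0"
    proof
      fix c
      show "h c = h0 c"
      proof (cases "c \<in> carrier (Jac G)")
        case True
        show ?thesis
        proof (rule poly_mapping_eqI)
          fix m
          show "Poly_Mapping.lookup (h c) m = Poly_Mapping.lookup (h0 c) m"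
            using True fh[of m] 0[OF True, of m] by (auto simp: h0_def lookup_poly_restrict)
        qed
      next
        case False
        then show ?thesis using PiE_arb[OF h False] by (simp add: h0_def)
      qed
    qed
  qed
qed

subsection \<open>Monomial primary and secondary invariants\<close>

lemma jac_class_smult:
  assumes "div_degree A = 0"
  shows "jac_class G (int k *s A) = jac_class G A [^]\<^bsub>Jac G\<^esub> k"
proof -
  interpret J: comm_group "Jac G" by (rule comm_group_Jac)
  have c: "jac_class G A \<in> carrier (Jac G)" using assms by (auto simp: carrier_Jac)
  show ?thesis
  proof (induction k)
    case 0
    have "jac_class G 0 = \<one>\<^bsub>Jac G\<^esub>" by (simp add: jac_class_eq Jac_def)
    then show ?case by simp
  next
    case (Suc k)
    have "int (Suc k) *s A = int k *s A + A" by (simp add: vec_eq_iff algebra_simps)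
    moreover have "jac_class G (int k *s A + A) =
        jac_class G (int k *s A) \<otimes>\<^bsub>Jac G\<^esub> jac_class G A"
      using assms by (intro jac_class_add) (simp_all add: div_degree_smult)
    ultimately show ?case using Suc by (simp only: J.nat_pow_Suc)
  qed
qed

lemma ord_q_dvd_iff: "ord_q G q v dvd k \<longleftrightarrow> Poly_Mapping.single v k \<in> class_exps G q 0"
proof -
  interpret J: comm_group "Jac G" by (rule comm_group_Jac)
  let ?A = "vertex_div v - vertex_div q"
  have c: "jac_class G ?A \<in> carrier (Jac G)" by (auto simp: carrier_Jac div_degree_vertex_diff)
  have one: "jac_class G 0 = \<one>\<^bsub>Jac G\<^esub>" by (simp add: jac_class_eq Jac_def)
  have "ord_q G q v dvd k \<longleftrightarrow> jac_class G ?A [^]\<^bsub>Jac G\<^esub> k = \<one>\<^bsub>Jac G\<^esub>"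
    unfolding ord_q_def using J.pow_eq_id[OF c] by simp
  also have "\<dots> \<longleftrightarrow> Poly_Mapping.single v k \<in> class_exps G q 0"
    by (simp add: class_exps_iff_jac_class class_divisor_single one
        jac_class_smult[OF div_degree_vertex_diff] del: vector_ssub_ldistrib)
  finally show ?thesis .
qed

lemma primary_multiplicities_iff:
  "primary_multiplicities G q l \<longleftrightarrow>
    (\<forall>v. 0 < l v \<and> Poly_Mapping.single v (l v) \<in> class_exps G q 0)"
  by (simp add: primary_multiplicities_def ord_q_dvd_iff)

text \<open>These are the exponents of products of the powers \<open>x_v^(l v)\<close>.\<close>

definition mult_exps :: "('v::finite \<Rightarrow> nat) \<Rightarrow> ('v \<Rightarrow>\<^sub>0 nat) set" where
  "mult_exps l = {m. \<forall>v. l v dvd Poly_Mapping.lookup m v}"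

lemma mult_exps_subset_class_exps:
  assumes "primary_multiplicities G q l"
  shows "mult_exps l \<subseteq> class_exps G q 0"
proof
  fix m assume m: "m \<in> mult_exps l"
  have "int (Poly_Mapping.lookup m v) *s (vertex_div v - vertex_div q) \<in> principal G" for v
  proof -
    obtain k where k: "Poly_Mapping.lookup m v = l v * k" using m by (auto simp: mult_exps_def)
    have "int (l v) *s (vertex_div v - vertex_div q) \<in> principal G"
      using assms by (simp add: primary_multiplicities_iff class_exps_def class_divisor_single)
    from principal_smult[OF this, of "int k"] show ?thesis
      by (simp add: k vector_smult_assoc mult.commute)
  qed
  then show "m \<in> class_exps G q 0"
    by (simp add: class_exps_def class_divisor_def principal_sum)
qed

text \<open>The effect on exponents of substituting \<open>x_v^(l v)\<close> for each variable
  \<open>x_v\<close>.\<close>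

definition scale_exp :: "('v::finite \<Rightarrow> nat) \<Rightarrow> ('v \<Rightarrow>\<^sub>0 nat) \<Rightarrow> 'v \<Rightarrow>\<^sub>0 nat" where
  "scale_exp l m = exp_comb (\<lambda>v. Poly_Mapping.single v (l v)) (Poly_Mapping.lookup m)"

lemma lookup_scale_exp:
  "Poly_Mapping.lookup (scale_exp l m) v = Poly_Mapping.lookup m v * l v"
  by (simp add: scale_exp_def lookup_exp_comb lookup_single when_def
      if_distrib[of "\<lambda>x. _ * x"] cong: if_cong)

lemma range_scale_exp: "range (scale_exp l) = mult_exps l"
proof (intro equalityI subsetI)
  fix m assume m: "m \<in> mult_exps l"
  have "m = scale_exp l (Abs_poly_mapping (\<lambda>v. Poly_Mapping.lookup m v div l v))"
    by (rule poly_mapping_eqI) (use m in \<open>simp add: lookup_scale_exp mult_exps_def\<close>)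
  then show "m \<in> range (scale_exp l)" by blast
qed (auto simp: mult_exps_def lookup_scale_exp)

lemma inj_scale_exp:
  assumes "\<And>v. 0 < l v"
  shows "inj (scale_exp l)"
proof (rule injI)
  fix m k assume eq: "scale_exp l m = scale_exp l k"
  show "m = k"
  proof (rule poly_mapping_eqI)
    fix v
    have "Poly_Mapping.lookup m v * l v = Poly_Mapping.lookup k v * l v"
      using eq by (simp flip: lookup_scale_exp)
    then show "Poly_Mapping.lookup m v = Poly_Mapping.lookup k v" using assms[of v] by simp
  qed
qed

abbreviation power_vars :: "('v::finite \<Rightarrow> nat) \<Rightarrow> 'v \<Rightarrow> 'v cpoly" where
  "power_vars l v \<equiv> monom_exp (Poly_Mapping.single v (l v))"

lemma subst_poly_power_vars:
  "subst_poly (power_vars l) f =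
    (\<Sum>m\<in>Poly_Mapping.keys f. Poly_Mapping.single (scale_exp l m) (Poly_Mapping.lookup f m))"
  by (simp add: subst_poly_single scale_exp_def)

lemma lookup_subst_poly_power_vars:
  assumes "\<And>v. 0 < l v"
  shows "Poly_Mapping.lookup (subst_poly (power_vars l) f) (scale_exp l m) =
    Poly_Mapping.lookup f m"
  by (simp add: subst_poly_power_vars lookup_sum lookup_single when_def in_keys_iff
      inj_eq[OF inj_scale_exp[of l, OF assms]])

text \<open>The substitution sends distinct monomials to distinct monomials, so all coefficients of
  \<open>f\<close> survive in the result.\<close>

lemma alg_independent_power_vars:
  assumes "\<And>v. 0 < l v"
  shows "alg_independent (power_vars l)"
  unfolding alg_independent_def
proof (intro allI impI poly_mapping_eqI)
  fix f m assume "subst_poly (power_vars l) f = 0"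
  then show "Poly_Mapping.lookup f m = Poly_Mapping.lookup 0 m"
    using lookup_subst_poly_power_vars[of l f m, OF assms] by simp
qed

lemma gen_subalgebra_power_vars:
  assumes "\<And>v. 0 < l v"
  shows "gen_subalgebra (power_vars l) = polys_on (mult_exps l)"
proof
  show sub: "gen_subalgebra (power_vars l) \<subseteq> polys_on (mult_exps l)"
    unfolding gen_subalgebra_def subst_poly_power_vars
    by (auto intro!: polys_on_sum) (auto simp: polys_on_def simp flip: range_scale_exp)
  show "polys_on (mult_exps l) \<subseteq> gen_subalgebra (power_vars l)"
  proof
    fix g assume g: "g \<in> polys_on (mult_exps l)"
    \<comment> \<open>The preimage of \<open>g\<close> is obtained by pulling its coefficients back
      along the injection \<open>scale_exp l\<close>.\<close>
    let ?f = "Poly_Mapping.map_key (scale_exp l) g"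
    have lk: "Poly_Mapping.lookup ?f m = Poly_Mapping.lookup g (scale_exp l m)" for m
      by (simp add: map_key.rep_eq[OF inj_scale_exp[of l, OF assms]])
    have "g = subst_poly (power_vars l) ?f"
    proof (rule poly_mapping_eqI)
      fix m
      show "Poly_Mapping.lookup g m = Poly_Mapping.lookup (subst_poly (power_vars l) ?f) m"
      proof (cases "m \<in> mult_exps l")
        case True
        then obtain k where "m = scale_exp l k" unfolding range_scale_exp[symmetric] by blast
        then show ?thesis by (simp add: lookup_subst_poly_power_vars[of l, OF assms] lk)
      next
        case False
        have "subst_poly (power_vars l) ?f \<in> polys_on (mult_exps l)"
          using sub by (auto simp: gen_subalgebra_def)
        then show ?thesis using polys_on_lookup[OF g False] polys_on_lookup[OF _ False] by simp
      qed
    qed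
    then show "g \<in> gen_subalgebra (power_vars l)" unfolding gen_subalgebra_def by blast
  qed
qed

section \<open>Freeness by division with remainder in the exponents\<close>

lemma finite_bounded_exps: "finite {m :: 'v::finite \<Rightarrow>\<^sub>0 nat. \<forall>v. Poly_Mapping.lookup m v < l v}"
proof (rule finite_imageD)
  show "finite (Poly_Mapping.lookup ` {m :: 'v \<Rightarrow>\<^sub>0 nat. \<forall>v. Poly_Mapping.lookup m v < l v})"
    by (rule finite_subset[of _ "Pi\<^sub>E UNIV (\<lambda>v. {..<l v})"]) (auto intro!: finite_PiE)
  show "inj_on Poly_Mapping.lookup {m :: 'v \<Rightarrow>\<^sub>0 nat. \<forall>v. Poly_Mapping.lookup m v < l v}"
    by (rule inj_onI) (rule poly_mapping_eq_iff[THEN iffD2])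
qed

lemma exp_division:
  assumes l: "\<And>v. 0 < l v"
  obtains k r where "m = k + r" "k \<in> mult_exps l" "\<And>v. Poly_Mapping.lookup r v < l v"
proof
  let ?k = "Abs_poly_mapping (\<lambda>v. Poly_Mapping.lookup m v div l v * l v)"
  let ?r = "Abs_poly_mapping (\<lambda>v. Poly_Mapping.lookup m v mod l v)"
  show "m = ?k + ?r" by (rule poly_mapping_eqI) (simp add: lookup_add)
  show "?k \<in> mult_exps l" by (simp add: mult_exps_def)
  show "Poly_Mapping.lookup ?r v < l v" for v using l by simp
qed

lemma exp_division_unique:
  assumes eq: "k + r = k' + r'" and "k \<in> mult_exps l" "k' \<in> mult_exps l"
    and "\<And>v. Poly_Mapping.lookup r v < l v" "\<And>v. Poly_Mapping.lookup r' v < l v"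
  shows "r = r'"
proof (rule poly_mapping_eqI)
  fix v
  have r: "Poly_Mapping.lookup (a + b) v mod l v = Poly_Mapping.lookup b v"
    if "a \<in> mult_exps l" "Poly_Mapping.lookup b v < l v" for a b
    using that by (auto simp: mult_exps_def lookup_add elim!: allE[of _ v] dvdE)
  show "Poly_Mapping.lookup r v = Poly_Mapping.lookup r' v"
    using r[of k r] r[of k' r'] assms by simp
qed

text \<open>The free basis consists of the monomials whose exponents are remainders \<open>r\<close>
  in \<open>Z\<close>. By the hypothesis on \<open>Z\<close>, a sum \<open>k + r\<close> with
  \<open>k\<close> in \<open>mult_exps l\<close> lies in \<open>Z\<close> exactly when
  \<open>r\<close> does.\<close>

lemma fin_free_module_power_vars:
  fixes l :: "'v::finite \<Rightarrow> nat"
  assumes l: "\<And>v. 0 < l v" and Z: "\<And>m k. k \<in> mult_exps l \<Longrightarrow> m + k \<in> Z \<longleftrightarrow> m \<in> Z"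
  shows "fin_free_module (gen_subalgebra (power_vars l)) (polys_on Z)"
proof -
  define R where "R = {r \<in> Z. \<forall>v. Poly_Mapping.lookup r v < l v}"
  define B :: "'v cpoly set" where "B = monom_exp ` R"
  let ?S = "polys_on (mult_exps l)"
  have finR: "finite R" using finite_bounded_exps[of l] by (auto simp: R_def intro: finite_subset)
  have sumB: "(\<Sum>b\<in>B. a b * b) = (\<Sum>r\<in>R. a (monom_exp r) * monom_exp r)" for a :: "'v cpoly \<Rightarrow> _"
    unfolding B_def by (subst sum.reindex) (auto intro: inj_on_subset[OF inj_monom_exp])
  \<comment> \<open>Uniqueness of the remainder: only the basis element with exponent
    \<open>r\<close> can contribute at \<open>k + r\<close>.\<close>
  have lk: "Poly_Mapping.lookup (\<Sum>b\<in>B. a b * b) (k + r) = Poly_Mapping.lookup (a (monom_exp r)) k"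
    if a: "a \<in> B \<rightarrow> ?S" and k: "k \<in> mult_exps l" and r: "r \<in> R" for a k r
  proof -
    have "Poly_Mapping.lookup (a (monom_exp s) * monom_exp s) (k + r) = 0"
      if s: "s \<in> R" "s \<noteq> r" for s
    proof (rule ccontr)
      assume "\<not> ?thesis"
      then have "k + r \<in> Poly_Mapping.keys (a (monom_exp s) * monom_exp s)"
        by (simp add: in_keys_iff)
      then obtain k' where k': "k' \<in> Poly_Mapping.keys (a (monom_exp s))" "k + r = k' + s"
        using keys_times_monom_exp by blast
      have "monom_exp s \<in> B" using s by (auto simp: B_def)
      then have "k' \<in> mult_exps l" using a k'(1) by (auto simp: polys_on_def)
      then show False using exp_division_unique[OF k'(2) k] r s by (auto simp: R_def)
    qed
    then have "Poly_Mapping.lookup (\<Sum>b\<in>B. a b * b) (k + r) =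
        (\<Sum>s\<in>R. if s = r then Poly_Mapping.lookup (a (monom_exp r)) k else 0)"
      unfolding sumB lookup_sum by (intro sum.cong) (auto simp: lookup_times_monom_exp)
    then show ?thesis using finR r by simp
  qed
  have mem: "(\<Sum>b\<in>B. a b * b) \<in> polys_on Z" if a: "a \<in> B \<rightarrow> ?S" for a
    unfolding sumB
  proof (rule polys_on_sum)
    fix r assume r: "r \<in> R"
    then have "a (monom_exp r) \<in> ?S" using a by (auto simp: B_def)
    then show "a (monom_exp r) * monom_exp r \<in> polys_on Z"
      using keys_times_monom_exp[of "a (monom_exp r)" r] r Z[of _ r]
      by (fastforce simp: polys_on_def R_def add.commute)
  qed
  have "bij_betw (\<lambda>a. \<Sum>b\<in>B. a b * b) (B \<rightarrow>\<^sub>E ?S) (polys_on Z)"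
  proof (rule bij_betwI')
    fix a a' assume a: "a \<in> B \<rightarrow>\<^sub>E ?S" and a': "a' \<in> B \<rightarrow>\<^sub>E ?S"
    show "((\<Sum>b\<in>B. a b * b) = (\<Sum>b\<in>B. a' b * b)) = (a = a')"
    proof
      assume eq: "(\<Sum>b\<in>B. a b * b) = (\<Sum>b\<in>B. a' b * b)"
      show "a = a'"
      proof (rule PiE_ext[OF a a'])
        fix b assume b: "b \<in> B"
        then obtain r where r: "r \<in> R" "b = monom_exp r" by (auto simp: B_def)
        show "a b = a' b"
        proof (rule poly_mapping_eqI)
          fix k
          show "Poly_Mapping.lookup (a b) k = Poly_Mapping.lookup (a' b) k"
          proof (cases "k \<in> mult_exps l")
            case True
            have "a \<in> B \<rightarrow> ?S" "a' \<in> B \<rightarrow> ?S" using a a' by auto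
            from lk[OF this(1) True r(1)] lk[OF this(2) True r(1)] show ?thesis
              by (simp only: eq r(2))
          next
            case False
            then show ?thesis using PiE_mem[OF a b] PiE_mem[OF a' b] by (simp add: polys_on_lookup)
          qed
        qed
      qed
    qed simp
  next
    fix a assume "a \<in> B \<rightarrow>\<^sub>E ?S"
    then show "(\<Sum>b\<in>B. a b * b) \<in> polys_on Z" by (intro mem) auto
  next
    fix f assume f: "f \<in> polys_on Z"
    \<comment> \<open>To find the coefficient of a basis monomial, divide \<open>f\<close> by it and
      keep only the exponents in \<open>mult_exps l\<close>.\<close>
    define a where "a = (\<lambda>b\<in>B. poly_restrict (mult_exps l)
      (Poly_Mapping.map_key (\<lambda>k. k + inv_into UNIV monom_exp b) f))"
    have lka: "Poly_Mapping.lookup (a (monom_exp r)) k = Poly_Mapping.lookup f (k + r)"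
      if "r \<in> R" "k \<in> mult_exps l" for r k
      using that by (simp add: a_def B_def lookup_poly_restrict inv_f_f[OF inj_monom_exp]
          map_key.rep_eq inj_def)
    have a: "a \<in> B \<rightarrow>\<^sub>E ?S"
      by (auto simp: a_def poly_restrict_in_polys_on)
    have "f = (\<Sum>b\<in>B. a b * b)"
    proof (rule poly_mapping_eqI)
      fix m
      show "Poly_Mapping.lookup f m = Poly_Mapping.lookup (\<Sum>b\<in>B. a b * b) m"
      proof (cases "m \<in> Z")
        case True
        obtain k r where kr: "m = k + r" "k \<in> mult_exps l" "\<And>v. Poly_Mapping.lookup r v < l v"
          using exp_division[of l m, OF l] by blast
        have "r \<in> R" using True kr Z[of k r] by (auto simp: R_def add.commute)
        moreover have "a \<in> B \<rightarrow> ?S" using a by auto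
        ultimately show ?thesis using lk[of a k r] kr(1,2) lka[of r k] by simp
      next
        case False
        have "a \<in> B \<rightarrow> ?S" using a by auto
        from polys_on_lookup[OF mem[OF this] False] polys_on_lookup[OF f False]
        show ?thesis by simp
      qed
    qed
    then show "\<exists>a\<in>B \<rightarrow>\<^sub>E ?S. f = (\<Sum>b\<in>B. a b * b)" using a by blast
  qed
  moreover have "finite B" "B \<subseteq> polys_on Z"
    using finR by (auto simp: B_def R_def monom_exp_in_polys_on)
  ultimately show ?thesis
    unfolding fin_free_module_def gen_subalgebra_power_vars[of l, OF l] by blast
qed

lemma primary_invariants_power_vars:
  assumes conn: "connected_multigraph G" and l: "primary_multiplicities G q l"
  shows "primary_invariants (Jac_Gamma G q) (power_vars l)"
proof -
  have pos: "0 < l v" and Z: "Poly_Mapping.single v (l v) \<in> class_exps G q 0" for v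
    using l by (auto simp: primary_multiplicities_iff)
  have "fin_free_module (gen_subalgebra (power_vars l)) (polys_on (class_exps G q 0))"
    by (rule fin_free_module_power_vars[of l, OF pos])
      (use mult_exps_subset_class_exps[OF l] class_exps_add_iff in blast)
  then show ?thesis
    unfolding primary_invariants_def invariants_eq[OF conn]
    using alg_independent_power_vars[of l, OF pos] Z
    by (simp add: monom_exp_in_polys_on homogeneous_monom_exp)
qed

text \<open>
  If no \<open>p v\<close> is a pure power of \<open>x u\<close>, then the algebra generated by \<open>p\<close> contains only constants
  among the pure powers of \<open>x u\<close>, so a finitely generated module over it contains only finitely
  many of these powers.
\<close>

lemma fin_free_module_pure_power:
  fixes g :: "'v::finite \<Rightarrow> 'v \<Rightarrow>\<^sub>0 nat"
  assumes free: "fin_free_module (gen_subalgebra (\<lambda>v. monom_exp (g v))) M"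
    and unbounded: "\<And>K. \<exists>j\<ge>K. monom_exp (Poly_Mapping.single u j) \<in> M"
  obtains v j where "0 < j" "g v = Poly_Mapping.single u j"
proof (rule ccontr)
  assume "\<not> thesis"
  then have no: "j = 0" if "g v = Poly_Mapping.single u j" for v j
    using that \<open>\<And>j v. 0 < j \<Longrightarrow> g v = Poly_Mapping.single u j \<Longrightarrow> thesis\<close> by blast
  obtain B where B: "finite B" and
    bij: "bij_betw (\<lambda>a. \<Sum>b\<in>B. a b * b) (B \<rightarrow>\<^sub>E gen_subalgebra (\<lambda>v. monom_exp (g v))) M"
    using free by (auto simp: fin_free_module_def)
  let ?E = "(\<lambda>m. Poly_Mapping.lookup m u) ` (\<Union>b\<in>B. Poly_Mapping.keys b)"
  have fin: "finite ?E" using B by auto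
  \<comment> \<open>This power exceeds the degree in \<open>x_u\<close> of every monomial occurring
    in a generator, so the missing factor must come from the coefficient algebra.\<close>
  obtain j where j: "j \<ge> Suc (Max ?E)" and M: "monom_exp (Poly_Mapping.single u j) \<in> M"
    using unbounded by blast
  obtain a where a: "a \<in> B \<rightarrow>\<^sub>E gen_subalgebra (\<lambda>v. monom_exp (g v))"
    and eq: "monom_exp (Poly_Mapping.single u j) = (\<Sum>b\<in>B. a b * b)"
    using bij M unfolding bij_betw_def by blast
  have "Poly_Mapping.lookup (\<Sum>b\<in>B. a b * b) (Poly_Mapping.single u j) \<noteq> 0"
    unfolding eq[symmetric] by simp
  then have "(\<Sum>b\<in>B. Poly_Mapping.lookup (a b * b) (Poly_Mapping.single u j)) \<noteq> 0"
    by (simp add: lookup_sum)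
  then obtain b where b: "b \<in> B" "Poly_Mapping.single u j \<in> Poly_Mapping.keys (a b * b)"
    by (metis (no_types, lifting) in_keys_iff sum.neutral)
  then obtain k1 k2 where k: "k1 \<in> Poly_Mapping.keys (a b)" "k2 \<in> Poly_Mapping.keys b"
    and sum: "Poly_Mapping.single u j = k1 + k2"
    using keys_mult[of "a b" b] by auto
  have zero: "Poly_Mapping.lookup k1 w = 0" if "w \<noteq> u" for w
  proof -
    have "Poly_Mapping.lookup (Poly_Mapping.single u j) w = 0" using that by (simp add: lookup_single)
    then show ?thesis unfolding sum by (simp add: lookup_add)
  qed
  obtain f where "a b = subst_poly (\<lambda>v. monom_exp (g v)) f"
    using PiE_mem[OF a b(1)] by (auto simp: gen_subalgebra_def)
  then have "k1 \<in> Poly_Mapping.keys (\<Sum>m\<in>Poly_Mapping.keys f.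
      Poly_Mapping.single (exp_comb g (Poly_Mapping.lookup m)) (Poly_Mapping.lookup f m))"
    using k(1) by (simp add: subst_poly_single)
  then have "(\<Sum>m\<in>Poly_Mapping.keys f. Poly_Mapping.lookup
      (Poly_Mapping.single (exp_comb g (Poly_Mapping.lookup m)) (Poly_Mapping.lookup f m)) k1) \<noteq> 0"
    by (simp add: in_keys_iff lookup_sum)
  then obtain m where m: "k1 = exp_comb g (Poly_Mapping.lookup m)"
    by (metis (no_types, lifting) lookup_single_not_eq sum.neutral)
  \<comment> \<open>Since \<open>k1\<close> involves only the variable \<open>u\<close>, any
    generator used in it is a power of \<open>x_u\<close>, hence constant by
    \<open>no\<close>.\<close>
  have "Poly_Mapping.lookup m v * Poly_Mapping.lookup (g v) u = 0" for v
  proof (cases "Poly_Mapping.lookup m v = 0")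
    case False
    have "g v = Poly_Mapping.single u (Poly_Mapping.lookup (g v) u)"
    proof (rule poly_mapping_eqI)
      fix w
      show "Poly_Mapping.lookup (g v) w =
          Poly_Mapping.lookup (Poly_Mapping.single u (Poly_Mapping.lookup (g v) u)) w"
        using zero[of w] False
        by (cases "w = u") (auto simp: m lookup_exp_comb lookup_single dest: spec[of _ v])
    qed
    from no[OF this] show ?thesis by simp
  qed simp
  then have "Poly_Mapping.lookup k1 u = 0" by (simp add: m lookup_exp_comb)
  moreover have "j = Poly_Mapping.lookup k1 u + Poly_Mapping.lookup k2 u"
    using sum by (metis lookup_add lookup_single_eq)
  moreover have "Poly_Mapping.lookup k2 u \<le> Max ?E"
    using fin b(1) k(2) by (intro Max_ge) auto
  ultimately show False using j by simp
qed

text \<open>Each variable has a pure power among the generators, and there are as many generators as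
  variables. So every generator is such a power, and its invariance forces the divisibility by the
  order.\<close>

lemma primary_invariants_monomialE:
  fixes G :: "'v::finite multigraph"
  assumes conn: "connected_multigraph G" and p: "primary_invariants (Jac_Gamma G q) p"
    and mon: "range p \<subseteq> monomials"
  obtains l \<sigma> where "primary_multiplicities G q l" "bij \<sigma>" "\<And>u. p (\<sigma> u) = power_vars l u"
proof -
  have "\<forall>v. \<exists>m. p v = monom_exp m" using mon by (auto simp: monomials_eq)
  then obtain g where g: "p = (\<lambda>v. monom_exp (g v))" by metis
  have inv: "g v \<in> class_exps G q 0" for v
    using p by (simp add: primary_invariants_def invariants_eq[OF conn] g monom_exp_in_polys_on)
  have free: "fin_free_module (gen_subalgebra (\<lambda>v. monom_exp (g v))) (polys_on (class_exps G q 0))"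
    using p by (simp add: primary_invariants_def invariants_eq[OF conn] g)
  obtain N where N: "0 < N" "\<And>D. div_degree D = 0 \<Longrightarrow> int N *s D \<in> principal G"
    using ex_exponent_Jac[OF conn] by blast
  have unb: "\<exists>j\<ge>K. monom_exp (Poly_Mapping.single u j) \<in> polys_on (class_exps G q 0)" for u K
  proof (intro exI conjI)
    \<comment> \<open>Exponents divisible by the annihilator \<open>N\<close> of the Jacobian give
      invariant powers, and \<open>N * K\<close> is at least \<open>K\<close>.\<close>
    show "K \<le> N * K" using N(1) by simp
    have "int (N * K) *s (vertex_div u - vertex_div q) =
        int N *s (int K *s (vertex_div u - vertex_div q))" by (simp only: vector_smult_assoc of_nat_mult)
    then show "monom_exp (Poly_Mapping.single u (N * K)) \<in> polys_on (class_exps G q 0)"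
      using N(2)[of "int K *s (vertex_div u - vertex_div q)"]
      by (simp add: monom_exp_in_polys_on class_exps_def class_divisor_single div_degree_smult
          div_degree_vertex_diff del: vector_ssub_ldistrib vector_smult_assoc)
  qed
  have "\<forall>u. \<exists>v j. 0 < j \<and> g v = Poly_Mapping.single u j"
    using fin_free_module_pure_power[OF free unb] by metis
  then obtain \<sigma> l where l: "\<And>u. 0 < l u" "\<And>u. g (\<sigma> u) = Poly_Mapping.single u (l u)" by metis
  \<comment> \<open>A nonconstant pure power determines its variable, so one generator cannot serve
    two variables.\<close>
  have "inj \<sigma>"
  proof (rule injI)
    fix u w assume "\<sigma> u = \<sigma> w"
    then have "Poly_Mapping.single u (l u) = Poly_Mapping.single w (l w)" by (metis l(2))
    then have "Poly_Mapping.lookup (Poly_Mapping.single w (l w)) u = l u" by (metis lookup_single_eq)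
    then show "u = w" using l(1)[of u] by (auto simp: lookup_single when_def split: if_splits)
  qed
  then have "bij \<sigma>" by (simp add: bij_def finite_UNIV_inj_surj)
  moreover have "primary_multiplicities G q l"
    using l inv by (metis primary_multiplicities_iff)
  ultimately show ?thesis using that l(2) by (simp add: g)
qed

lemma range_power_vars_reindex:
  assumes "bij \<sigma>" "\<And>u. p (\<sigma> u) = power_vars l u"
  shows "range p = range (power_vars l)"
proof -
  have "range p = p ` range \<sigma>" using assms(1) by (simp add: bij_is_surj)
  then show ?thesis by (simp add: image_image assms(2))
qed

text \<open>A monomial ideal is determined by divisibility of exponents; the hypothesis on
  \<open>C\<close> ensures that quotients by the generators stay in the module.\<close>

lemma ideal_power_vars:
  fixes l :: "'v::finite \<Rightarrow> nat"
  assumes C: "\<And>v m. m + Poly_Mapping.single v (l v) \<in> C \<longleftrightarrow> m \<in> C"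
  shows "{\<Sum>v\<in>UNIV. power_vars l v * h v | h. \<forall>v. h v \<in> polys_on C} =
    polys_on {m \<in> C. \<exists>v. l v \<le> Poly_Mapping.lookup m v}" (is "?L = ?R")
proof (intro equalityI subsetI)
  fix f assume "f \<in> ?L"
  then obtain h where h: "\<And>v. h v \<in> polys_on C" and f: "f = (\<Sum>v\<in>UNIV. power_vars l v * h v)"
    by auto
  show "f \<in> ?R" unfolding f
  proof (rule polys_on_sum)
    fix v
    have "m \<in> C \<and> (\<exists>v. l v \<le> Poly_Mapping.lookup m v)"
      if m: "m \<in> Poly_Mapping.keys (h v * power_vars l v)" for m
    proof -
      obtain k where k: "k \<in> Poly_Mapping.keys (h v)" "m = k + Poly_Mapping.single v (l v)"
        using m keys_times_monom_exp by blast
      have "m \<in> C" using k C h[of v] by (auto simp: polys_on_def)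
      moreover have "l v \<le> Poly_Mapping.lookup m v" by (simp add: k lookup_add)
      ultimately show ?thesis by blast
    qed
    then show "power_vars l v * h v \<in> ?R" by (auto simp: polys_on_def mult.commute)
  qed
next
  fix f assume f: "f \<in> ?R"
  \<comment> \<open>Assign to each monomial one variable whose power divides it. This splits
    \<open>f\<close> into pieces, the one for \<open>v\<close> being divisible by
    \<open>x_v^(l v)\<close>.\<close>
  define w where "w m = (SOME v. l v \<le> Poly_Mapping.lookup m v)" for m
  define h where "h v = Poly_Mapping.map_key (\<lambda>k. k + Poly_Mapping.single v (l v))
    (poly_restrict {m. w m = v} f)" for v
  have lk: "Poly_Mapping.lookup (h v) k =
      (if w (k + Poly_Mapping.single v (l v)) = v
       then Poly_Mapping.lookup f (k + Poly_Mapping.single v (l v)) else 0)" for v k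
    by (simp add: h_def map_key.rep_eq inj_def lookup_poly_restrict)
  have hC: "h v \<in> polys_on C" for v
    by (rule polys_onI) (use polys_on_lookup[OF f] C in \<open>auto simp: lk\<close>)
  have piece: "power_vars l v * h v = poly_restrict {m. w m = v} f" for v
  proof (rule poly_mapping_eqI)
    fix m
    show "Poly_Mapping.lookup (power_vars l v * h v) m =
        Poly_Mapping.lookup (poly_restrict {m. w m = v} f) m"
    proof (cases "l v \<le> Poly_Mapping.lookup m v")
      case True
      have "m = (m - Poly_Mapping.single v (l v)) + Poly_Mapping.single v (l v)"
        by (rule poly_mapping_eqI) (use True in \<open>auto simp: lookup_add lookup_minus lookup_single when_def\<close>)
      then obtain k where k: "m = k + Poly_Mapping.single v (l v)" by blast
      show ?thesis
        unfolding k mult.commute[of "power_vars l v"] lookup_times_monom_exp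
        by (simp add: lk lookup_poly_restrict)
    next
      case False
      have "m \<notin> Poly_Mapping.keys (h v * power_vars l v)"
      proof
        assume "m \<in> Poly_Mapping.keys (h v * power_vars l v)"
        then obtain k where "m = k + Poly_Mapping.single v (l v)"
          using keys_times_monom_exp by blast
        then show False using False by (simp add: lookup_add)
      qed
      then have "Poly_Mapping.lookup (power_vars l v * h v) m = 0"
        by (simp add: in_keys_iff mult.commute[of "power_vars l v"])
      \<comment> \<open>If the variable chosen for \<open>m\<close> fails the divisibility, then no
        variable satisfies it, so \<open>m\<close> is outside the support of
        \<open>f\<close>.\<close>
      moreover have "Poly_Mapping.lookup f m = 0" if w: "w m = v"
      proof (rule polys_on_lookup[OF f])
        show "m \<notin> {m \<in> C. \<exists>v. l v \<le> Poly_Mapping.lookup m v}"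
          using False someI_ex[of "\<lambda>v. l v \<le> Poly_Mapping.lookup m v"] w by (auto simp: w_def)
      qed
      ultimately show ?thesis by (simp add: lookup_poly_restrict)
    qed
  qed
  have "f = (\<Sum>v\<in>UNIV. power_vars l v * h v)"
    by (rule poly_mapping_eqI) (simp add: piece lookup_sum lookup_poly_restrict)
  then show "f \<in> ?L" using hC by blast
qed

section \<open>Secondary invariants and the two bijections\<close>

definition secondary_exps ::
    "'v::finite multigraph \<Rightarrow> 'v \<Rightarrow> 'v divisor \<Rightarrow> ('v \<Rightarrow> nat) \<Rightarrow> ('v \<Rightarrow>\<^sub>0 nat) set" where
  "secondary_exps G q D l = {m \<in> class_exps G q D. \<forall>v. Poly_Mapping.lookup m v < l v}"

lemma secondary_divisors_eq:
  "div_degree D = 0 \<Longrightarrow> secondary_divisors G q D l = exp_divisor ` secondary_exps G q D l"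
  by (auto simp: secondary_divisors_def effective_class_eq secondary_exps_def exp_divisor_def)

lemma primary_divisors_eq:
  "primary_divisors l = exp_divisor ` range (\<lambda>v. Poly_Mapping.single v (l v))"
proof -
  have "int (l v) *s vertex_div v = exp_divisor (Poly_Mapping.single v (l v))" for v
    by (auto simp: vec_eq_iff exp_divisor_def vertex_div_def axis_def lookup_single when_def)
  then show ?thesis by (simp add: primary_divisors_def image_image)
qed

text \<open>Reordering the primary invariants by \<sigma> leaves the submodule they generate
  unchanged. Its exponents are those of the class with some entry at least \<open>l v\<close>, so
  the secondary exponents form the complement within the class.\<close>

lemma secondary_invariants_iff:
  fixes G :: "'v::finite multigraph"
  assumes conn: "connected_multigraph G" and D: "div_degree D = 0"
    and l: "primary_multiplicities G q l"
    and \<sigma>: "bij \<sigma>" "\<And>u. p (\<sigma> u) = power_vars l u" and Q: "Q \<subseteq> monomials"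
  shows "secondary_invariants (Jac_Gamma G q) (jac_char G q (jac_class G D)) p Q \<longleftrightarrow>
    Q = monom_exp ` secondary_exps G q D l"
proof -
  let ?C = "class_exps G q D"
  let ?T = "{m \<in> ?C. \<exists>v. l v \<le> Poly_Mapping.lookup m v}"
  have "{\<Sum>v\<in>UNIV. p v * h v | h. \<forall>v. h v \<in> polys_on ?C} =
      {\<Sum>v\<in>UNIV. power_vars l v * h v | h. \<forall>v. h v \<in> polys_on ?C}" (is "?L = ?R")
  proof (intro equalityI subsetI)
    fix f assume "f \<in> ?L"
    then obtain h where h: "\<forall>v. h v \<in> polys_on ?C" "f = (\<Sum>v\<in>UNIV. p v * h v)" by blast
    have "f = (\<Sum>u\<in>UNIV. power_vars l u * h (\<sigma> u))"
      using sum.reindex_bij_betw[OF \<sigma>(1), of "\<lambda>v. p v * h v"] h(2) by (simp add: \<sigma>(2))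
    then show "f \<in> ?R" using h(1) by (auto intro!: exI[of _ "\<lambda>u. h (\<sigma> u)"])
  next
    fix f assume "f \<in> ?R"
    then obtain h where h: "\<forall>v. h v \<in> polys_on ?C" "f = (\<Sum>v\<in>UNIV. power_vars l v * h v)" by blast
    let ?h = "\<lambda>v. h (inv_into UNIV \<sigma> v)"
    have "f = (\<Sum>v\<in>UNIV. p v * ?h v)"
      using sum.reindex_bij_betw[OF \<sigma>(1), of "\<lambda>v. p v * ?h v"] h(2)
      by (simp add: \<sigma>(2) inv_f_f[OF bij_is_inj[OF \<sigma>(1)]])
    then show "f \<in> ?L" using h(1) by (auto intro!: exI[of _ ?h])
  qed
  also have "\<dots> = polys_on ?T"
    by (rule ideal_power_vars, rule class_exps_add_iff)
      (use l in \<open>simp add: primary_multiplicities_iff\<close>)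
  finally have W: "{\<Sum>v\<in>UNIV. p v * h v | h. \<forall>v. h v \<in> polys_on ?C} = polys_on ?T" .
  have CT: "?C - ?T = secondary_exps G q D l" by (auto simp: secondary_exps_def simp flip: not_le)
  have "finite (secondary_exps G q D l)"
    using finite_bounded_exps[of l] by (auto simp: secondary_exps_def intro: finite_subset)
  then have "basis_modulo Q (polys_on ?C) (polys_on ?T) \<longleftrightarrow>
      Q = monom_exp ` secondary_exps G q D l"
    using basis_modulo_polys_on_iff[of ?T ?C Q] Q CT by (auto simp: monomials_eq)
  moreover have "homogeneous_poly f" if "f \<in> Q" for f
    using that Q homogeneous_monom_exp by (auto simp: monomials_eq)
  ultimately show ?thesis
    unfolding secondary_invariants_def rel_invariants_eq[OF conn D] W by blast
qed

text \<open>Injectivity is inherited from that of \<open>div_monomial\<close> on effective divisors;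
  surjectivity is the classification of monomial primary invariants.\<close>

lemma bij_betw_primary:
  fixes G :: "'v::finite multigraph"
  assumes conn: "connected_multigraph G"
  shows "bij_betw (\<lambda>P. div_monomial ` P)
       {primary_divisors l | l. primary_multiplicities G q l}
       {range p | p. primary_invariants (Jac_Gamma G q) p \<and> range p \<subseteq> monomials}"
  unfolding bij_betw_def
proof
  show "inj_on (\<lambda>P. div_monomial ` P) {primary_divisors l | l. primary_multiplicities G q l}"
    by (rule inj_on_subset[OF inj_on_image_Pow[OF inj_on_div_monomial]])
      (auto simp: primary_divisors_eq effective_exp_divisor)
  have im: "div_monomial ` primary_divisors l = range (power_vars l)" for l :: "'v \<Rightarrow> nat"
    by (simp add: primary_divisors_eq image_image div_monomial_exp_divisor)
  show "(\<lambda>P. div_monomial ` P) ` {primary_divisors l | l. primary_multiplicities G q l} =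
      {range p | p. primary_invariants (Jac_Gamma G q) p \<and> range p \<subseteq> monomials}" (is "?L = ?R")
  proof (intro equalityI subsetI)
    fix X assume "X \<in> ?L"
    then obtain l where "primary_multiplicities G q l" "X = range (power_vars l)"
      by (auto simp: im)
    then show "X \<in> ?R" using primary_invariants_power_vars[OF conn]
      by (auto simp: monomials_eq intro!: exI[of _ "power_vars l"])
  next
    fix X assume "X \<in> ?R"
    then obtain p where p: "primary_invariants (Jac_Gamma G q) p" "range p \<subseteq> monomials" "X = range p"
      by blast
    obtain l \<sigma> where l: "primary_multiplicities G q l" "bij \<sigma>" "\<And>u. p (\<sigma> u) = power_vars l u"
      using primary_invariants_monomialE[OF conn p(1,2)] by blast
    then have "X = div_monomial ` primary_divisors l"
      unfolding p(3) im by (intro range_power_vars_reindex)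
    then show "X \<in> ?L" using l(1) by blast
  qed
qed

text \<open>Both components must come from the same \<open>l\<close>. For surjectivity it is read
  off from the primary component, after which \<open>secondary_invariants_iff\<close> leaves only
  one possible \<open>Q\<close>.\<close>

lemma bij_betw_secondary:
  fixes G :: "'v::finite multigraph"
  assumes conn: "connected_multigraph G" and D: "div_degree D = 0"
  shows "bij_betw (\<lambda>(P, S). (div_monomial ` P, div_monomial ` S))
          {(primary_divisors l, secondary_divisors G q D l) | l. primary_multiplicities G q l}
          {(range p, Q) | p Q.
             primary_invariants (Jac_Gamma G q) p \<and> range p \<subseteq> monomials \<and>
             secondary_invariants (Jac_Gamma G q) (jac_char G q (jac_class G D)) p Q \<and>
             Q \<subseteq> monomials}"
  unfolding bij_betw_def
proof
  let ?E = "{E :: 'v divisor. effective E}"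
  have "inj_on (\<lambda>(P, S). (div_monomial ` P, div_monomial ` S)) (Pow ?E \<times> Pow ?E)"
    using inj_on_image_Pow[OF inj_on_div_monomial] by (auto simp: inj_on_def)
  then show "inj_on (\<lambda>(P, S). (div_monomial ` P, div_monomial ` S))
      {(primary_divisors l, secondary_divisors G q D l) | l. primary_multiplicities G q l}"
    by (rule inj_on_subset)
      (auto simp: primary_divisors_eq secondary_divisors_eq[OF D] effective_exp_divisor)
  have im: "div_monomial ` primary_divisors l = range (power_vars l)"
    "div_monomial ` secondary_divisors G q D l = monom_exp ` secondary_exps G q D l"
    for l :: "'v \<Rightarrow> nat"
    by (simp_all add: primary_divisors_eq secondary_divisors_eq[OF D]
        image_image div_monomial_exp_divisor)
  show "(\<lambda>(P, S). (div_monomial ` P, div_monomial ` S)) `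
        {(primary_divisors l, secondary_divisors G q D l) | l. primary_multiplicities G q l} =
      {(range p, Q) | p Q.
         primary_invariants (Jac_Gamma G q) p \<and> range p \<subseteq> monomials \<and>
         secondary_invariants (Jac_Gamma G q) (jac_char G q (jac_class G D)) p Q \<and>
         Q \<subseteq> monomials}" (is "?L = ?R")
  proof (intro equalityI subsetI)
    fix X assume "X \<in> ?L"
    then obtain l where l: "primary_multiplicities G q l"
      and X: "X = (range (power_vars l), monom_exp ` secondary_exps G q D l)"
      by (auto simp: im)
    have Q: "monom_exp ` secondary_exps G q D l \<subseteq> monomials" by (auto simp: monomials_eq)
    have "secondary_invariants (Jac_Gamma G q) (jac_char G q (jac_class G D)) (power_vars l)
        (monom_exp ` secondary_exps G q D l)"
      using secondary_invariants_iff[OF conn D l bij_id, of "power_vars l"] Q by simp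
    moreover have "range (power_vars l) \<subseteq> monomials" by (auto simp: monomials_eq)
    ultimately show "X \<in> ?R" using primary_invariants_power_vars[OF conn l] Q X by blast
  next
    fix X assume "X \<in> ?R"
    then obtain p Q where p: "primary_invariants (Jac_Gamma G q) p" "range p \<subseteq> monomials"
      and Q: "secondary_invariants (Jac_Gamma G q) (jac_char G q (jac_class G D)) p Q"
        "Q \<subseteq> monomials" and X: "X = (range p, Q)"
      by blast
    obtain l \<sigma> where l: "primary_multiplicities G q l" "bij \<sigma>" "\<And>u. p (\<sigma> u) = power_vars l u"
      using primary_invariants_monomialE[OF conn p] by blast
    have "Q = monom_exp ` secondary_exps G q D l"
      using secondary_invariants_iff[OF conn D l Q(2)] Q(1) by blast
    moreover have "range p = range (power_vars l)" using l(2,3) by (rule range_power_vars_reindex)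
    ultimately have "X = (\<lambda>(P, S). (div_monomial ` P, div_monomial ` S))
        (primary_divisors l, secondary_divisors G q D l)"
      by (simp add: X im)
    then show "X \<in> ?L" using l(1) by blast
  qed
qed

theorem theorem5p1:
  fixes G :: "'v::finite multigraph" and q :: 'v
  assumes "connected_multigraph G"
  shows
    "(\<forall>D. div_degree D = 0 \<longrightarrow>
        cpoly.independent (div_monomial ` effective_class G q D) \<and>
        cpoly.span (div_monomial ` effective_class G q D) =
          rel_invariants (Jac_Gamma G q) (jac_char G q (jac_class G D))) \<and>
     (\<forall>f :: 'v cpoly. \<exists>!h.
        h \<in> (\<Pi>\<^sub>E c\<in>carrier (Jac G). rel_invariants (Jac_Gamma G q) (jac_char G q c)) \<and>
        f = (\<Sum>c\<in>carrier (Jac G). h c)) \<and>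
     bij_betw (\<lambda>P. div_monomial ` P)
       {primary_divisors l | l. primary_multiplicities G q l}
       {range p | p. primary_invariants (Jac_Gamma G q) p \<and> range p \<subseteq> monomials} \<and>
     (\<forall>D. div_degree D = 0 \<longrightarrow>
        bij_betw (\<lambda>(P, S). (div_monomial ` P, div_monomial ` S))
          {(primary_divisors l, secondary_divisors G q D l) | l. primary_multiplicities G q l}
          {(range p, Q) | p Q.
             primary_invariants (Jac_Gamma G q) p \<and> range p \<subseteq> monomials \<and>
             secondary_invariants (Jac_Gamma G q) (jac_char G q (jac_class G D)) p Q \<and>
             Q \<subseteq> monomials})"
proof (intro conjI allI impI)
  fix D :: "'v divisor" assume D: "div_degree D = 0"
  show "cpoly.independent (div_monomial ` effective_class G q D)"
    by (simp add: effective_class_eq[OF D] div_monomial_image_exp_divisor independent_monom_exp)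
  show "cpoly.span (div_monomial ` effective_class G q D) =
      rel_invariants (Jac_Gamma G q) (jac_char G q (jac_class G D))"
    by (simp add: effective_class_eq[OF D] div_monomial_image_exp_divisor span_monom_exp
        rel_invariants_eq[OF assms D])
  show "bij_betw (\<lambda>(P, S). (div_monomial ` P, div_monomial ` S))
      {(primary_divisors l, secondary_divisors G q D l) | l. primary_multiplicities G q l}
      {(range p, Q) | p Q.
         primary_invariants (Jac_Gamma G q) p \<and> range p \<subseteq> monomials \<and>
         secondary_invariants (Jac_Gamma G q) (jac_char G q (jac_class G D)) p Q \<and>
         Q \<subseteq> monomials}"
    by (rule bij_betw_secondary[OF assms D])
next
  show "bij_betw (\<lambda>P. div_monomial ` P)
      {primary_divisors l | l. primary_multiplicities G q l}
      {range p | p. primary_invariants (Jac_Gamma G q) p \<and> range p \<subseteq> monomials}"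
    by (rule bij_betw_primary[OF assms])
next
  fix f :: "'v cpoly"
  show "\<exists>!h. h \<in> (\<Pi>\<^sub>E c\<in>carrier (Jac G). rel_invariants (Jac_Gamma G q) (jac_char G q c)) \<and>
      f = (\<Sum>c\<in>carrier (Jac G). h c)"
    by (rule ex1_decomposition[OF assms])
qed

end
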